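(* On the set of half-synchronized systems, define $X\sim Y$ to mean that $X$ and $Y$ have a common half-synchronized hyperbolic extension, i.e. there exist a half-synchronized system $V$ and hyperbolic factor maps $\varphi_X: V\to X$ and $\varphi_Y: V\to Y$. Then $\sim$ is an equivalence relation on the set of half-synchronized systems.
   Context: A subshift (shift space) $X$ over a finite non-empty alphabet $\mathcal A$ is a closed shift-invariant subset of $\mathcal A^{\mathbb Z}$ (with the shift map $\sigma(x)_i=x_{i+1}$). $\mathcal B_n(X)$ is the set of blocks of length $n$ occurring in points of $X$, and $\mathcal B(X)=\bigcup_{n\ge 0}\mathcal B_n(X)$ is the language of $X$; $|u|$ is the length of a block $u$, and $x_{[i,j]}=x_i x_{i+1}\cdots x_j$. $X$ is transitive (irreducible) if for all $u,v\in\mathcal B(X)$ there is a block $w$ with $uwv\in\mathcal B(X)$. A factor map $\varphi:X\to Y$ is an onto sliding block code, i.e. a surjective map for which there are integers $m,n$ with $-m\le n$ and a block map $\Phi:\mathcal B_{m+n+1}(X)\to\mathcal D$ ($\mathcal D$ the alphabet of $Y$) such that $\varphi(x)_i=\Phi(x_{[i-m,i+n]})$ for all $i\in\mathbb Z$. Follower sets: $X^+=\{(x_i)_{i\ge 0}: x\in X\}$. For a left-infinite ray $x_-$ of $X$ (the left half of a point of $X$, such as $x_{(-\infty,0]}$, up to re-indexing), $\omega_+(x_-)$ is the set of right-infinite rays $x_+\in X^+$ such that the concatenation $x_-x_+$ is a point of $X$. For a block $m\in\mathcal B(X)$, $\omega_+(m)$ is the set of right-infinite rays $x_+\in X^+$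 such that $m x_+$ occurs in a point of $X$ (that is, some point of $X$ has a right ray equal to $mx_+$). A point $x\in X$ is left-transitive if every block of $\mathcal B(X)$ appears in $x$ infinitely often to the left. Half-synchronized: a transitive subshift $X$ is half-synchronized (a half-synchronized system) if there is a block $m\in\mathcal B(X)$ and a left-transitive point $x\in X$ such that $x_{[-|m|+1,0]}=m$ and $\omega_+(x_{(-\infty,0]})=\omega_+(m)$. Hyperbolic: a factor map $\varphi:X\to Y$ between transitive subshifts is hyperbolic if there are $d\in\mathbb N$, integers $n,k\ge 0$, a block $w\in\mathcal B_{2n+1}(Y)$ and $d$ blocks $m^{(1)},\dots,m^{(d)}\in\mathcal B_{2k+1}(X)$ such that: (1) if $y\in Y$ satisfies $y_{[-n,n]}=w$, then $\{x_{[-k,k]}: x\in\varphi^{-1}(y)\}=\{m^{(1)},\dots,m^{(d)}\}$; (2) if $w'\in\mathcal B(Y)$ begins and ends with $w$, of length $|w'|=2n+1+p$ with $p\ge 0$, then for each $1\le i\le d$ there is a unique block $a^i\in\mathcal B(X)$ such that for every $x\in X$ with $\varphi(x)_{[-n,n+p]}=w'$ and $x_{[-k,k]}=m^{(i)}$ one has $x_{[-k,k+p]}=a^i$. *)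

theory Defs
  imports "HOL-Analysis.Analysis" "HOL-Library.Sublist" "HOL-Library.Infinite_Typeclass"
begin

definition shift :: "(int \<Rightarrow> 'a) \<Rightarrow> (int \<Rightarrow> 'a)" where
  "shift x = (\<lambda>i. x (i + 1))"

(* The full shift over A is the topological product of copies of the discrete space A indexed by
   the integers; closedin includes X \<subseteq> (UNIV \<rightarrow> A).  Shift-invariance of a two-sided
   subshift is the equality shift ` X = X, not just an inclusion. *)
definition subshift_over :: "'a set \<Rightarrow> (int \<Rightarrow> 'a) set \<Rightarrow> bool" where
  "subshift_over A X \<longleftrightarrow>
     finite A \<and> A \<noteq> {} \<and>
     closedin (product_topology (\<lambda>_::int. discrete_topology A) UNIV) X \<and>
     shift ` X = X"

definition subshift :: "(int \<Rightarrow> 'a) set \<Rightarrow> bool" where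
  "subshift X \<longleftrightarrow> (\<exists>A. subshift_over A X)"

(* The block x_i x_(i+1) ... x_j, empty if j < i. *)
definition block :: "(int \<Rightarrow> 'a) \<Rightarrow> int \<Rightarrow> int \<Rightarrow> 'a list" where
  "block x i j = map x [i..j]"

definition blocks :: "nat \<Rightarrow> (int \<Rightarrow> 'a) set \<Rightarrow> 'a list set" where
  "blocks n X = {block x i (i + int n - 1) | x i. x \<in> X}"

definition language :: "(int \<Rightarrow> 'a) set \<Rightarrow> 'a list set" where
  "language X = (\<Union>n. blocks n X)"

definition transitive_subshift :: "(int \<Rightarrow> 'a) set \<Rightarrow> bool" where
  "transitive_subshift X \<longleftrightarrow>
     subshift X \<and>
     (\<forall>u\<in>language X. \<forall>v\<in>language X. \<exists>w. u @ w @ v \<in> language X)"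

(* Only the restriction of f to X matters, and only the values of \<Phi> on the blocks of length
   m + n + 1 of X matter; these lie in the alphabet of Y because f ` X = Y. *)
definition factor_map ::
    "((int \<Rightarrow> 'a) \<Rightarrow> (int \<Rightarrow> 'b)) \<Rightarrow> (int \<Rightarrow> 'a) set \<Rightarrow> (int \<Rightarrow> 'b) set \<Rightarrow> bool" where
  "factor_map f X Y \<longleftrightarrow>
     f ` X = Y \<and>
     (\<exists>(m::int) (n::int) (\<Phi> :: 'a list \<Rightarrow> 'b).
        - m \<le> n \<and> (\<forall>x\<in>X. \<forall>i. f x i = \<Phi> (block x (i - m) (i + n))))"

(* Right-infinite rays are functions on nat read from left to right; left-infinite rays are
   functions on nat read from right to left, so that l 0 is the last symbol of the ray l. *)

definition right_rays :: "(int \<Rightarrow> 'a) set \<Rightarrow> (nat \<Rightarrow> 'a) set" where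
  "right_rays X = {(\<lambda>k. x (int k)) | x. x \<in> X}"

definition left_ray_at_0 :: "(int \<Rightarrow> 'a) \<Rightarrow> (nat \<Rightarrow> 'a)" where
  "left_ray_at_0 x = (\<lambda>k. x (- int k))"

(* The last symbol of l is put at coordinate 0 and the first symbol of r at coordinate 1. *)
definition join_rays :: "(nat \<Rightarrow> 'a) \<Rightarrow> (nat \<Rightarrow> 'a) \<Rightarrow> (int \<Rightarrow> 'a)" where
  "join_rays l r = (\<lambda>i. if i \<le> 0 then l (nat (- i)) else r (nat (i - 1)))"

definition follower_ray :: "(int \<Rightarrow> 'a) set \<Rightarrow> (nat \<Rightarrow> 'a) \<Rightarrow> (nat \<Rightarrow> 'a) set" where
  "follower_ray X l = {r \<in> right_rays X. join_rays l r \<in> X}"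

definition follower_block :: "(int \<Rightarrow> 'a) set \<Rightarrow> 'a list \<Rightarrow> (nat \<Rightarrow> 'a) set" where
  "follower_block X m =
     {r \<in> right_rays X. \<exists>x\<in>X. \<exists>i.
        block x i (i + int (length m) - 1) = m \<and>
        (\<forall>k. x (i + int (length m) + int k) = r k)}"

definition left_transitive :: "(int \<Rightarrow> 'a) set \<Rightarrow> (int \<Rightarrow> 'a) \<Rightarrow> bool" where
  "left_transitive X x \<longleftrightarrow>
     x \<in> X \<and>
     (\<forall>u\<in>language X. infinite {i. i \<le> 0 \<and> block x i (i + int (length u) - 1) = u})"

definition half_synchronized :: "(int \<Rightarrow> 'a) set \<Rightarrow> bool" where
  "half_synchronized X \<longleftrightarrow>
     transitive_subshift X \<and>
     (\<exists>m\<in>language X. \<exists>x. left_transitive X x \<and>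
        block x (- int (length m) + 1) 0 = m \<and>
        follower_ray X (left_ray_at_0 x) = follower_block X m)"

definition hyperbolic ::
    "((int \<Rightarrow> 'a) \<Rightarrow> (int \<Rightarrow> 'b)) \<Rightarrow> (int \<Rightarrow> 'a) set \<Rightarrow> (int \<Rightarrow> 'b) set \<Rightarrow> bool" where
  "hyperbolic f X Y \<longleftrightarrow>
     transitive_subshift X \<and> transitive_subshift Y \<and> factor_map f X Y \<and>
     (\<exists>(d::nat) (n::nat) (k::nat) (w :: 'b list) (m :: nat \<Rightarrow> 'a list).
        w \<in> blocks (2 * n + 1) Y \<and>
        (\<forall>i\<in>{1..d}. m i \<in> blocks (2 * k + 1) X) \<and>
        (\<forall>y\<in>Y. block y (- int n) (int n) = w \<longrightarrow>
           {block x (- int k) (int k) | x. x \<in> X \<and> f x = y} = m ` {1..d}) \<and>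
        (\<forall>w'\<in>language Y. \<forall>p::nat.
           prefix w w' \<and> suffix w w' \<and> length w' = 2 * n + 1 + p \<longrightarrow>
           (\<forall>i\<in>{1..d}. \<exists>!a. a \<in> language X \<and>
              (\<forall>x\<in>X. block (f x) (- int n) (int n + int p) = w' \<and>
                      block x (- int k) (int k) = m i \<longrightarrow>
                      block x (- int k) (int k + int p) = a))))"

(* All systems, including the common extension V, use symbols from one infinite type 'a; since
   alphabets are finite, this is no restriction up to renaming symbols. *)
definition common_hs_hyperbolic_extension ::
    "(int \<Rightarrow> 'a::infinite) set \<Rightarrow> (int \<Rightarrow> 'a) set \<Rightarrow> bool" where
  "common_hs_hyperbolic_extension X Y \<longleftrightarrow>
     (\<exists>(V :: (int \<Rightarrow> 'a) set) f g.
        half_synchronized V \<and> hyperbolic f V X \<and> hyperbolic g V Y)"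

end

theory Submission
  imports Defs
begin

text \<open>
Reflexivity holds because the identity is hyperbolic, and symmetry is built into the definition.
Transitivity is the content: from hyperbolic extensions \<open>V\<close> of \<open>X\<close> and \<open>Y\<close>, and \<open>W\<close> of \<open>Y\<close> and \<open>Z\<close>,
one needs a half-synchronized \<open>U\<close> with hyperbolic maps to \<open>V\<close> and \<open>W\<close> that can then be composed with
the given maps to \<open>X\<close> and \<open>Z\<close>.

The key simplification is that, between transitive subshifts, a factor map is hyperbolic as soon as
it is determined to the right: for some word of \<open>Y\<close>, whenever that word occurs at two positions of an
image point, the image block spanning the two occurrences together with the central block of the
preimage at the first occurrence determines the preimage in between (\<open>resolving\<close>;
\<open>hyperbolic_if_resolving\<close>). The other requirement, that every image point containing the word has
the same central blocks in its fibre, comes for free: among all patterns extending the word take one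
whose set of central preimage blocks is smallest; then no extension of the pattern can lose a
block, and compactness lifts each block to each point (\<open>resolving_imp_lifting\<close>).
Since the central blocks form a finite set, determinism to the right is a surjection of a
finite set onto itself, hence a permutation, so that there is also determinism to the left
(\<open>resolving_backwards\<close>).

Three facts about hyperbolic maps follow. A suitable image pattern forces a given block to appear in
every preimage, because there are finitely many lifts of a word and they can be treated one after
another (\<open>every_lift_visits\<close>). Therefore hyperbolic maps compose (\<open>hyperbolic_compose\<close>), preimages of
left-transitive points are left-transitive (\<open>left_transitive_lift\<close>), and half-synchronization passes
from \<open>Y\<close> to its hyperbolic extensions (\<open>half_synchronized_lift\<close>): a right ray that may follow the
synchronizing block upstairs is, downstairs, spliced to the left-transitive ray, and the result is
lifted back.

It remains to find a transitive subshift \<open>U\<close> of the fibre product of \<open>V\<close> and \<open>W\<close> over \<open>Y\<close> that projects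
onto both factors. For a left-transitive point \<open>v\<close> of \<open>V\<close> there are only finitely many left rays of \<open>W\<close>
over the left ray of its image, and a pigeonhole argument yields a point \<open>w\<close> over the image of \<open>v\<close>
such that the pair \<open>(v, w)\<close> recurs to its own left (\<open>recurrent_lift\<close>). The orbit closure of the
pair is transitive; it projects onto \<open>V\<close> and \<open>W\<close> because \<open>v\<close> and \<open>w\<close> are both left-transitive; and the
projections inherit determinism to the right from the maps to \<open>Y\<close> (\<open>projection_hyperbolic\<close>). As the
symbol type is infinite, pairs of symbols can be coded by single symbols.
\<close>

section \<open>Points compared on windows\<close>

definition agree :: "int \<Rightarrow> int \<Rightarrow> (int \<Rightarrow> 'a) \<Rightarrow> (int \<Rightarrow> 'a) \<Rightarrow> bool" where
  "agree a b x y \<longleftrightarrow> (\<forall>i. a \<le> i \<and> i \<le> b \<longrightarrow> x i = y i)"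

text \<open>
A word of odd length \<open>2 * N + 1\<close> is represented by a point \<open>w\<close> that carries it in the window from \<open>- N\<close>
to \<open>N\<close>, and its position in \<open>x\<close> is the position of its centre. This replaces list manipulations
by comparisons of points, and the pattern can be enlarged by increasing \<open>N\<close> alone.
\<close>

definition occurs :: "int \<Rightarrow> (int \<Rightarrow> 'a) \<Rightarrow> int \<Rightarrow> (int \<Rightarrow> 'a) \<Rightarrow> bool" where
  "occurs N w q x \<longleftrightarrow> (\<forall>i. - N \<le> i \<and> i \<le> N \<longrightarrow> x (q + i) = w i)"

definition translate :: "int \<Rightarrow> (int \<Rightarrow> 'a) \<Rightarrow> (int \<Rightarrow> 'a)" where
  "translate q x = (\<lambda>i. x (i + q))"

lemma agree_sym: "agree a b x y \<Longrightarrow> agree a b y x"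
  by (auto simp: agree_def)

lemma agree_trans: "agree a b x y \<Longrightarrow> agree a b y z \<Longrightarrow> agree a b x z"
  by (auto simp: agree_def)

lemma agree_mono: "agree a b x y \<Longrightarrow> a \<le> c \<Longrightarrow> d \<le> b \<Longrightarrow> agree c d x y"
  by (auto simp: agree_def)

lemma occurs_mono: "occurs N w q x \<Longrightarrow> M \<le> N \<Longrightarrow> occurs M w q x"
  by (auto simp: occurs_def)

lemma occurs_translate [simp]: "occurs N w q (translate s x) \<longleftrightarrow> occurs N w (q + s) x"
  by (auto simp: occurs_def translate_def ac_simps)

lemma occurs_self: "occurs N x 0 x"
  by (simp add: occurs_def)

lemma occurs_eq_agree: "occurs N w 0 x \<longleftrightarrow> agree (- N) N x w"
  by (auto simp: occurs_def agree_def)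

lemma occurs_shift_agree: "occurs N w q x \<longleftrightarrow> agree (- N) N (translate q x) w"
  by (auto simp: occurs_def agree_def translate_def ac_simps)

lemma occursD: "occurs N w q x \<Longrightarrow> \<bar>i - q\<bar> \<le> N \<Longrightarrow> x i = w (i - q)"
  unfolding occurs_def by (drule spec[of _ "i - q"]) auto

lemma occursI: "(\<And>i. \<bar>i - q\<bar> \<le> N \<Longrightarrow> x i = w (i - q)) \<Longrightarrow> occurs N w q x"
  unfolding occurs_def by auto

lemma agreeD: "agree a b x y \<Longrightarrow> a \<le> i \<Longrightarrow> i \<le> b \<Longrightarrow> x i = y i"
  by (simp add: agree_def)

lemma occurs_comp:
  assumes "occurs N z q x" "occurs M w p z" "\<bar>p\<bar> + M \<le> N"
  shows "occurs M w (q + p) x"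
proof (rule occursI)
  fix i assume "\<bar>i - (q + p)\<bar> \<le> M"
  then show "x i = w (i - (q + p))"
    using occursD[OF assms(1), of i] occursD[OF assms(2), of "i - q"] assms(3)
    by (simp add: algebra_simps)
qed

lemma occurs_agree:
  assumes "occurs N w q x" "agree a b x y" "a \<le> q - N" "q + N \<le> b"
  shows "occurs N w q y"
proof (rule occursI)
  fix i assume "\<bar>i - q\<bar> \<le> N"
  then show "y i = w (i - q)"
    using occursD[OF assms(1), of i] agreeD[OF assms(2), of i] assms(3,4) by simp
qed

lemma translate_translate [simp]: "translate p (translate q x) = translate (p + q) x"
  by (simp add: translate_def ac_simps)

lemma translate_0 [simp]: "translate 0 x = x"
  by (simp add: translate_def)

lemma agree_translate [simp]: "agree a b (translate q x) (translate q y) \<longleftrightarrow> agree (a + q) (b + q) x y"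
proof
  assume *: "agree a b (translate q x) (translate q y)"
  show "agree (a + q) (b + q) x y"
    unfolding agree_def
  proof (intro allI impI)
    fix i assume "a + q \<le> i \<and> i \<le> b + q"
    then show "x i = y i" using agreeD[OF *, of "i - q"] by (simp add: translate_def)
  qed
qed (auto simp: agree_def translate_def)

lemma agree_append:
  assumes "agree a b x y" "agree c d x y" "c \<le> b + 1"
  shows "agree a d x y"
  unfolding agree_def
proof (intro allI impI)
  fix i assume "a \<le> i \<and> i \<le> d"
  then show "x i = y i"
    using agreeD[OF assms(1), of i] agreeD[OF assms(2), of i] assms(3) by linarith
qed

section \<open>Subshifts through windows\<close>

text \<open>
A basic open set of the product topology fixes membership at finitely many coordinates, and these lie
in one window; so closedness can be tested on windows around the origin.
\<close>

lemma closedin_iff_windows: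
  assumes "X \<subseteq> {x. range x \<subseteq> A}"
  shows "closedin (product_topology (\<lambda>_::int. discrete_topology A) UNIV) X \<longleftrightarrow>
    (\<forall>x. (\<forall>N. \<exists>x'\<in>X. agree (- N) N x' x) \<longrightarrow> x \<in> X)"
proof
  let ?T = "product_topology (\<lambda>_::int. discrete_topology A) UNIV"
  have top: "topspace ?T = {x. range x \<subseteq> A}"
    by (auto simp: PiE_def)
  assume cl: "closedin ?T X"
  show "\<forall>x. (\<forall>N. \<exists>x'\<in>X. agree (- N) N x' x) \<longrightarrow> x \<in> X"
  proof (intro allI impI, rule ccontr)
    fix x assume appr: "\<forall>N. \<exists>x'\<in>X. agree (- N) N x' x" and "x \<notin> X"
    have "range x \<subseteq> A"
    proof clarify
      fix i
      obtain x' where "x' \<in> X" "agree (- \<bar>i\<bar>) \<bar>i\<bar> x' x" using appr by blast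
      then have "x' i = x i" using agreeD[of _ _ x' x i] by auto
      moreover have "x' i \<in> A" using assms \<open>x' \<in> X\<close> by auto
      ultimately show "x i \<in> A" by auto
    qed
    then have "x \<in> topspace ?T - X" using \<open>x \<notin> X\<close> top by auto
    moreover have "openin ?T (topspace ?T - X)" using cl by blast
    ultimately have "\<exists>U. finite {i \<in> UNIV. U i \<noteq> topspace (discrete_topology A)} \<and>
        (\<forall>i\<in>UNIV. openin (discrete_topology A) (U i)) \<and> x \<in> Pi\<^sub>E UNIV U \<and>
        Pi\<^sub>E UNIV U \<subseteq> topspace ?T - X"
      unfolding openin_product_topology_alt by (rule bspec[rotated])
    then obtain U where U: "finite {i. U i \<noteq> A}" "x \<in> Pi\<^sub>E UNIV U"
      "Pi\<^sub>E UNIV U \<subseteq> topspace ?T - X"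
      by (elim exE conjE) (rule that, simp_all only: topspace_discrete_topology UNIV_I simp_thms)
    define N where "N = Max (insert 0 (abs ` {i. U i \<noteq> A}))"
    have N: "\<bar>i\<bar> \<le> N" if "U i \<noteq> A" for i
      unfolding N_def using U(1) that by (intro Max_ge) auto
    obtain x' where x': "x' \<in> X" "agree (- N) N x' x" using appr by blast
    have "x' i \<in> U i" for i
    proof (cases "U i = A")
      case True then show ?thesis using x'(1) assms by auto
    next
      case False
      then have "x' i = x i" using agreeD[OF x'(2), of i] N[of i] by linarith
      then show ?thesis using U(2) by auto
    qed
    then show False using U(3) x'(1) by (auto simp: PiE_def)
  qed
next
  let ?T = "product_topology (\<lambda>_::int. discrete_topology A) UNIV"
  have top: "topspace ?T = {x. range x \<subseteq> A}"
    by (auto simp: PiE_def)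
  assume appr: "\<forall>x. (\<forall>N. \<exists>x'\<in>X. agree (- N) N x' x) \<longrightarrow> x \<in> X"
  have "openin ?T (topspace ?T - X)"
    unfolding openin_product_topology_alt
  proof
    fix x assume x: "x \<in> topspace ?T - X"
    then obtain N where N: "\<And>x'. x' \<in> X \<Longrightarrow> \<not> agree (- N) N x' x" using appr by blast
    define U where "U i = (if \<bar>i\<bar> \<le> N then {x i} else A)" for i
    have xA: "x i \<in> A" for i using x top by auto
    have "{i. U i \<noteq> A} \<subseteq> {-N..N}" by (auto simp: U_def split: if_splits)
    then have "finite {i. U i \<noteq> A}" using finite_subset by blast
    moreover have "Pi\<^sub>E UNIV U \<subseteq> topspace ?T - X"
    proof
      fix x' assume x': "x' \<in> Pi\<^sub>E UNIV U"
      have U: "x' i \<in> U i" for i using x' by auto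
      moreover have "agree (- N) N x' x" unfolding agree_def
      proof (intro allI impI)
        fix i assume "- N \<le> i \<and> i \<le> N"
        then have "\<bar>i\<bar> \<le> N" by linarith
        then show "x' i = x i" using U[of i] by (simp add: U_def)
      qed
      moreover have "x' i \<in> A" for i using U[of i] xA[of i] by (simp add: U_def split: if_splits)
      ultimately show "x' \<in> topspace ?T - X" using N unfolding top by auto
    qed
    moreover have "x \<in> Pi\<^sub>E UNIV U" using xA by (auto simp: U_def)
    moreover have "\<forall>i. U i \<subseteq> A" using xA by (auto simp: U_def)
    ultimately show "\<exists>U. finite {i \<in> UNIV. U i \<noteq> topspace (discrete_topology A)} \<and>
             (\<forall>i\<in>UNIV. openin (discrete_topology A) (U i)) \<and> x \<in> Pi\<^sub>E UNIV U \<and> Pi\<^sub>E UNIV U \<subseteq> topspace ?T - X"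
      by (intro exI[of _ U]) simp
  qed
  then show "closedin ?T X" using assms top by (simp add: closedin_def)
qed

lemma subshift_overI:
  assumes "finite A" "A \<noteq> {}" "X \<subseteq> {x. range x \<subseteq> A}"
    and "\<And>x q. x \<in> X \<Longrightarrow> translate q x \<in> X"
    and "\<And>x. (\<And>N. \<exists>x'\<in>X. agree (- N) N x' x) \<Longrightarrow> x \<in> X"
  shows "subshift X"
proof -
  have sh: "shift = translate 1" by (auto simp: shift_def translate_def fun_eq_iff)
  have "shift ` X = X"
  proof
    show "X \<subseteq> shift ` X"
    proof
      fix x assume "x \<in> X"
      then have "translate (-1) x \<in> X" "x = shift (translate (-1) x)"
        using assms(4) by (auto simp: sh)
      then show "x \<in> shift ` X" by blast
    qed
    show "shift ` X \<subseteq> X" using assms(4) by (auto simp: sh)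
  qed
  then show ?thesis
    unfolding subshift_def subshift_over_def
    using assms closedin_iff_windows[OF assms(3)] by blast
qed

lemma subshift_alphabet:
  assumes "subshift X"
  obtains A where "finite A" "A \<noteq> {}" "X \<subseteq> {x. range x \<subseteq> A}"
    "closedin (product_topology (\<lambda>_::int. discrete_topology A) UNIV) X"
proof -
  obtain A where A: "subshift_over A X" using assms subshift_def by auto
  then have "X \<subseteq> topspace (product_topology (\<lambda>_::int. discrete_topology A) UNIV)"
    unfolding subshift_over_def by (meson closedin_subset)
  then have "X \<subseteq> {x. range x \<subseteq> A}" by (auto simp: PiE_def)
  then show thesis using that A unfolding subshift_over_def by blast
qed

lemma subshift_translate:
  assumes "subshift X" "x \<in> X"
  shows "translate q x \<in> X"
proof -
  have inv: "shift ` X = X" using assms unfolding subshift_def subshift_over_def by auto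
  have sh: "shift = translate 1" by (auto simp: shift_def translate_def fun_eq_iff)
  have up: "translate (int n) x \<in> X" if "x \<in> X" for n x
    using that
  proof (induction n)
    case (Suc n)
    then have "shift (translate (int n) x) \<in> X" using inv by blast
    then show ?case by (simp add: sh)
  qed simp
  have down: "translate (- int n) x \<in> X" if "x \<in> X" for n x
    using that
  proof (induction n)
    case (Suc n)
    then obtain y where "y \<in> X" "translate (- int n) x = translate 1 y" using inv sh by (metis imageE)
    then have "translate (-1) (translate (- int n) x) = y" by simp
    then show ?case using \<open>y \<in> X\<close> by simp
  qed simp
  show ?thesis
    using up[OF assms(2)] down[OF assms(2)] by (metis int_cases2)
qed

lemma subshift_closed:
  assumes "subshift X" "\<And>N. \<exists>x'\<in>X. agree (- N) N x' x"
  shows "x \<in> X"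
  using assms by (metis subshift_alphabet closedin_iff_windows)

text \<open>
Compactness in sequential form. The sets of accumulation points of the tails of the sequence, taken
together with the tails, form a decreasing sequence of nonempty closed sets in a compact space.
\<close>

lemma subshift_accumulation_point:
  fixes s :: "nat \<Rightarrow> int \<Rightarrow> 'a"
  assumes X: "subshift X" and s: "\<And>n. s n \<in> X"
  obtains x where "x \<in> X" "\<And>N M. \<exists>n\<ge>M. agree (- N) N (s n) x"
proof -
  obtain A where A: "finite A" "X \<subseteq> {x. range x \<subseteq> A}" using X by (rule subshift_alphabet)
  let ?T = "product_topology (\<lambda>_::int. discrete_topology A) UNIV"
  define D where "D M = {x\<in>X. \<forall>N. \<exists>x'\<in>s ` {M..}. agree (- N) N x' x}" for M :: nat
  have closed: "closedin ?T (D M)" for M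
  proof (subst closedin_iff_windows)
    show "D M \<subseteq> {x. range x \<subseteq> A}" using A unfolding D_def by auto
    show "\<forall>x. (\<forall>N. \<exists>x'\<in>D M. agree (- N) N x' x) \<longrightarrow> x \<in> D M"
    proof (intro allI impI)
      fix x assume *: "\<forall>N. \<exists>x'\<in>D M. agree (- N) N x' x"
      then have "x \<in> X" using subshift_closed[OF X] unfolding D_def by blast
      moreover have "\<exists>x'\<in>s ` {M..}. agree (- N) N x' x" for N
      proof -
        obtain x' where "x' \<in> D M" "agree (- N) N x' x" using * by blast
        then show ?thesis unfolding D_def using agree_trans by blast
      qed
      ultimately show "x \<in> D M" unfolding D_def by blast
    qed
  qed
  have "s M \<in> D M" for M using s unfolding D_def by (auto simp: agree_def)
  then have ne: "D M \<noteq> {}" for M by blast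
  have "decseq D"
    unfolding decseq_def D_def by fastforce
  moreover have "compact_space ?T"
    using A(1) by (simp add: compact_space_product_topology compact_space_discrete_topology)
  ultimately have "(\<Inter>n. D n) \<noteq> {}"
    using compact_space_imp_nest[of ?T D] closed ne by blast
  then obtain x where x: "\<And>M. x \<in> D M" by blast
  show thesis
  proof (rule that[of x])
    show "x \<in> X" using x[of 0] D_def by auto
    show "\<exists>n\<ge>M. agree (- N) N (s n) x" for N M
      using x[of M] unfolding D_def by auto
  qed
qed

section \<open>Blocks\<close>

lemma block_eq_iff: "block x a b = block y a b \<longleftrightarrow> agree a b x y"
  by (auto simp: block_def agree_def)

lemma length_block: "length (block x a b) = nat (b - a + 1)"
  by (simp add: block_def)

lemma block_nth: "j < nat (b - a + 1) \<Longrightarrow> block x a b ! j = x (a + int j)"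
  by (simp add: block_def)

lemma block_translate: "block (translate q x) a b = block x (a + q) (b + q)"
  by (rule nth_equalityI) (auto simp: length_block block_nth translate_def ac_simps)

lemma block_append:
  assumes "a \<le> b + 1" "b \<le> c"
  shows "block x a b @ block x (b + 1) c = block x a c"
proof (cases "a \<le> b")
  case True
  then show ?thesis using assms by (simp add: block_def upto_split2[of a b c])
next
  case False
  then have "a = b + 1" using assms by simp
  then show ?thesis by (simp add: block_def)
qed

lemma block_eq_appendD:
  assumes "block x a b = u @ v"
  shows "u = block x a (a + int (length u) - 1) \<and> v = block x (a + int (length u)) b"
proof (cases "v = []")
  case True
  then have "length u = nat (b - a + 1)" using assms by (metis length_block append_Nil2)
  then show ?thesis using assms True by (cases "a \<le> b + 1") (auto simp: block_def)
next
  case False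
  then have "0 < length v" by simp
  then have "int (length u) < b - a + 1" using assms by (metis length_append length_block nat_add_distrib
    add_less_cancel_left less_add_same_cancel1 zless_nat_eq_int_zless)
  then have "block x a (a + int (length u) - 1) @ block x (a + int (length u)) b = u @ v"
    using assms block_append[of a "a + int (length u) - 1" b x] by simp
  then show ?thesis by (simp add: append_eq_append_conv length_block)
qed

lemma block_in_language: "x \<in> X \<Longrightarrow> block x a b \<in> language X"
proof (cases "a \<le> b")
  case True
  assume "x \<in> X"
  then have "block x a (a + int (nat (b - a + 1)) - 1) \<in> language X"
    unfolding language_def blocks_def by blast
  then show ?thesis using True by simp
next
  case False
  assume "x \<in> X"
  then have "block x 0 (0 + int 0 - 1) \<in> language X"
    unfolding language_def blocks_def by blast
  then show ?thesis using False by (simp add: block_def)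
qed

lemma in_language_iff:
  assumes "subshift X"
  shows "u \<in> language X \<longleftrightarrow> (\<exists>x\<in>X. u = block x a (a + int (length u) - 1))"
proof
  assume "u \<in> language X"
  then obtain x i n where x: "x \<in> X" "u = block x i (i + int n - 1)"
    unfolding language_def blocks_def by auto
  then have "length u = n" by (simp add: length_block)
  with x have "u = block (translate (i - a) x) a (a + int (length u) - 1)"
    by (simp add: block_translate algebra_simps)
  then show "\<exists>x\<in>X. u = block x a (a + int (length u) - 1)"
    using subshift_translate[OF assms x(1)] by blast
qed (metis block_in_language)

text \<open>
Transitivity in terms of points: the gap between the two patterns can be made as large as desired
by first widening the windows, because occurrences of the wide patterns do not overlap.
\<close>

lemma transitive_subshift_iff:
  "transitive_subshift X \<longleftrightarrow> subshift X \<and>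
     (\<forall>x\<in>X. \<forall>y\<in>X. \<forall>N R. \<exists>z\<in>X. \<exists>q\<ge>R. occurs N x 0 z \<and> occurs N y q z)"
proof (cases "subshift X")
  case X: True
  show ?thesis
  proof (intro iffI conjI ballI allI X)
    fix x y and N R :: int assume tr: "transitive_subshift X" and xy: "x \<in> X" "y \<in> X"
    define M where "M = max 0 (max N R)"
    have M: "0 \<le> M" by (simp add: M_def)
    obtain u where u: "block x (-M) M @ u @ block y (-M) M \<in> language X"
      using tr xy block_in_language[of x X "-M" M] block_in_language[of y X "-M" M]
      unfolding transitive_subshift_def by blast
    obtain z b where z: "z \<in> X" and eq: "block z (-M) b = block x (-M) M @ u @ block y (-M) M"
      using in_language_iff[OF X, THEN iffD1, OF u, of "-M"] by (elim bexE) (rule that, assumption, rule sym)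
    define q where "q = 2 * M + 1 + int (length u)"
    from eq have 1: "block x (-M) M = block z (-M) M" and "u @ block y (-M) M = block z (M + 1) b"
      using block_eq_appendD[OF eq] M by (auto simp: length_block)
    then have "block y (-M) M = block z (q - M) b"
      using block_eq_appendD[of z "M + 1" b u] by (simp add: q_def algebra_simps)
    moreover have "b = q + M"
      using arg_cong[OF eq, of length] M by (simp add: length_block q_def)
    ultimately have "block y (-M) M = block (translate q z) (-M) M"
      by (simp add: block_translate add.commute)
    then have 3: "occurs M y q z" unfolding occurs_shift_agree block_eq_iff by (rule agree_sym)
    have 4: "occurs M x 0 z" using 1 unfolding occurs_eq_agree block_eq_iff by (rule agree_sym)
    have "N \<le> M" "R \<le> q" using M unfolding q_def by (simp_all add: M_def)
    then show "\<exists>z\<in>X. \<exists>q\<ge>R. occurs N x 0 z \<and> occurs N y q z"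
      using z occurs_mono[OF 3] occurs_mono[OF 4] by blast
  next
    assume *: "subshift X \<and> (\<forall>x\<in>X. \<forall>y\<in>X. \<forall>N R. \<exists>z\<in>X. \<exists>q\<ge>R. occurs N x 0 z \<and> occurs N y q z)"
    show "transitive_subshift X" unfolding transitive_subshift_def
    proof (intro conjI ballI X)
      fix u v assume u: "u \<in> language X" and v: "v \<in> language X"
      have "\<exists>x\<in>X. u = block x 0 (int (length u) - 1)" if "u \<in> language X" for u
        using in_language_iff[OF X, of u 0] that unfolding add_0 by (rule iffD1)
      from this[OF u] this[OF v] have eu: "\<exists>x\<in>X. u = block x 0 (int (length u) - 1)"
        and ev: "\<exists>x\<in>X. v = block x 0 (int (length v) - 1)" .
      from eu obtain x where x: "x \<in> X" "u = block x 0 (int (length u) - 1)" by (rule bexE)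
      from ev obtain y where y: "y \<in> X" "v = block y 0 (int (length v) - 1)" by (rule bexE)
      define N where "N = int (length u + length v)"
      obtain z q where z: "z \<in> X" "q \<ge> N + N" "occurs N x 0 z" "occurs N y q z"
        using *[THEN conjunct2, rule_format, OF x(1) y(1), of "N + N" N] by (elim bexE exE conjE) (rule that)
      have u: "block z 0 (int (length u) - 1) = u"
      proof -
        have "agree 0 (int (length u) - 1) z x"
          using z(3) unfolding occurs_eq_agree by (rule agree_mono) (auto simp: N_def)
        then have "block z 0 (int (length u) - 1) = block x 0 (int (length u) - 1)"
          by (simp only: block_eq_iff)
        then show ?thesis by (rule trans) (rule x(2)[symmetric])
      qed
      have v: "block z q (q + int (length v) - 1) = v"
      proof -
        have "agree 0 (int (length v) - 1) (translate q z) y"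
          using z(4) unfolding occurs_shift_agree by (rule agree_mono) (auto simp: N_def)
        then have "block (translate q z) 0 (int (length v) - 1) = block y 0 (int (length v) - 1)"
          by (simp only: block_eq_iff)
        also have "\<dots> = v" by (rule y(2)[symmetric])
        finally show ?thesis by (simp add: block_translate algebra_simps)
      qed
      have "block z 0 (int (length u) - 1) @ block z (int (length u)) (q - 1)
          @ block z q (q + int (length v) - 1) = block z 0 (q + int (length v) - 1)"
        using block_append[of 0 "int (length u) - 1" "q - 1" z] block_append[of 0 "q - 1" "q + int (length v) - 1" z] z(2)
        by (simp add: N_def) (metis append_assoc)
      then have "u @ block z (int (length u)) (q - 1) @ v = block z 0 (q + int (length v) - 1)"
        by (simp only: u v)
      then have "u @ block z (int (length u)) (q - 1) @ v \<in> language X"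
        using block_in_language[OF z(1)] by simp
      then show "\<exists>w. u @ w @ v \<in> language X" by blast
    qed
  qed
qed (auto simp: transitive_subshift_def)

lemma transitive_two_patterns:
  assumes X: "transitive_subshift X" and "x \<in> X" "y \<in> X"
  obtains z q where "z \<in> X" "R \<le> q" "occurs N x 0 z" "occurs M y q z"
proof -
  obtain z q where "z \<in> X" "R \<le> q" "occurs (max N M) x 0 z" "occurs (max N M) y q z"
    using assms unfolding transitive_subshift_iff by meson
  then show thesis using that occurs_mono by (metis max.cobounded1 max.cobounded2)
qed

section \<open>Sliding block codes\<close>

text \<open>
A sliding block code of memory and anticipation \<open>r\<close>, expressed without naming its block map.
\<close>

definition sliding :: "int \<Rightarrow> ((int \<Rightarrow> 'a) \<Rightarrow> (int \<Rightarrow> 'b)) \<Rightarrow> (int \<Rightarrow> 'a) set \<Rightarrow> bool" where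
  "sliding r f X \<longleftrightarrow> 0 \<le> r \<and>
     (\<forall>x\<in>X. \<forall>x'\<in>X. \<forall>i j. agree (- r) r (translate i x) (translate j x') \<longrightarrow> f x i = f x' j)"

lemma sliding_agree:
  assumes "sliding r f X" "x \<in> X" "x' \<in> X" "agree (a - r) (b + r) x x'"
  shows "agree a b (f x) (f x')"
  unfolding agree_def
proof (intro allI impI)
  fix i assume i: "a \<le> i \<and> i \<le> b"
  have "agree (- r) r (translate i x) (translate i x')"
    using agree_mono[OF assms(4), of "-r + i" "r + i"] i by simp
  then show "f x i = f x' i" using assms unfolding sliding_def by blast
qed

lemma sliding_translate:
  assumes "sliding r f X" "subshift X" "x \<in> X"
  shows "f (translate q x) = translate q (f x)"
proof
  fix i
  have "agree (- r) r (translate i (translate q x)) (translate (i + q) x)"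
    by (simp add: agree_def)
  then show "f (translate q x) i = translate q (f x) i"
    using assms subshift_translate[OF assms(2,3)] unfolding sliding_def translate_def[of q "f x"] by blast
qed

lemma sliding_occurs:
  assumes "sliding r f X" "subshift X" "x \<in> X" "w \<in> X" "occurs (N + r) w q x"
  shows "occurs N (f w) q (f x)"
proof -
  have "agree (- N) N (f (translate q x)) (f w)"
    using assms(5) by (intro sliding_agree[OF assms(1)] subshift_translate assms) (simp add: occurs_shift_agree)
  then show ?thesis using sliding_translate[OF assms(1-3)] by (simp add: occurs_shift_agree)
qed

lemma factor_map_iff_sliding:
  "factor_map f X Y \<longleftrightarrow> f ` X = Y \<and> (\<exists>r. sliding r f X)"
proof (intro iffI conjI)
  assume "factor_map f X Y"
  then obtain m n \<Phi> where \<Phi>: "\<And>x i. x \<in> X \<Longrightarrow> f x i = \<Phi> (block x (i - m) (i + n))"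
    unfolding factor_map_def by blast
  define r where "r = max \<bar>m\<bar> \<bar>n\<bar>"
  have r: "- r \<le> - m" "n \<le> r" "0 \<le> r" by (simp_all add: r_def)
  have "sliding r f X" unfolding sliding_def
  proof (intro conjI ballI allI impI r)
    fix x x' i j assume x: "x \<in> X" "x' \<in> X" and "agree (- r) r (translate i x) (translate j x')"
    then have "agree (- m) n (translate i x) (translate j x')" using r agree_mono by blast
    then have "block x (i - m) (i + n) = block x' (j - m) (j + n)"
      by (simp add: block_eq_iff[symmetric] block_translate add.commute)
    then show "f x i = f x' j" using \<Phi> x by simp
  qed
  then show "\<exists>r. sliding r f X" by blast
next
  assume *: "f ` X = Y \<and> (\<exists>r. sliding r f X)"
  then obtain r where r: "sliding r f X" by blast
  define \<Phi> where "\<Phi> b = (SOME s. \<exists>x\<in>X. \<exists>i. block x (i - r) (i + r) = b \<and> s = f x i)" for b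
  have "f x i = \<Phi> (block x (i - r) (i + r))" if x: "x \<in> X" for x i
  proof -
    have "\<exists>x'\<in>X. \<exists>j. block x' (j - r) (j + r) = block x (i - r) (i + r)
        \<and> \<Phi> (block x (i - r) (i + r)) = f x' j"
      unfolding \<Phi>_def by (rule someI_ex) (use x in blast)
    then obtain x' j where x': "x' \<in> X" "block x' (j - r) (j + r) = block x (i - r) (i + r)"
      "\<Phi> (block x (i - r) (i + r)) = f x' j" by blast
    have "block (translate j x') (- r) r = block (translate i x) (- r) r"
      using x'(2) by (simp add: block_translate add.commute)
    then have "f x' j = f x i" using r x x'(1) unfolding sliding_def block_eq_iff by blast
    then show ?thesis using x'(3) by simp
  qed
  moreover have "- r \<le> r" using r by (simp add: sliding_def)
  ultimately show "factor_map f X Y" using * unfolding factor_map_def by blast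
qed (simp add: factor_map_def)

section \<open>Hyperbolic maps as right-resolving maps\<close>

text \<open>
The second condition of hyperbolicity for the word that \<open>w\<close> carries in the window from \<open>- n\<close> to \<open>n\<close>,
with central blocks of length \<open>2 * k + 1\<close> in the domain; the words \<open>w'\<close> of that condition are
the image blocks spanning two occurrences, at \<open>a\<close> and at \<open>b\<close>.
\<close>

definition resolving ::
    "int \<Rightarrow> int \<Rightarrow> (int \<Rightarrow> 'b) \<Rightarrow> ((int \<Rightarrow> 'a) \<Rightarrow> (int \<Rightarrow> 'b)) \<Rightarrow> (int \<Rightarrow> 'a) set \<Rightarrow> bool" where
  "resolving n k w f X \<longleftrightarrow> (\<forall>x\<in>X. \<forall>x'\<in>X. \<forall>a b.
     a \<le> b \<and> occurs n w a (f x) \<and> occurs n w b (f x) \<and> agree (a - n) (b + n) (f x) (f x') \<and>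
     agree (a - k) (a + k) x x' \<longrightarrow> agree (a - k) (b + k) x x')"

text \<open>
The first condition of hyperbolicity: all points of the image that show the word have the same central
blocks in their fibres, so a central block met over one of them can be found over any other.
\<close>

definition lifting ::
    "int \<Rightarrow> int \<Rightarrow> (int \<Rightarrow> 'b) \<Rightarrow> ((int \<Rightarrow> 'a) \<Rightarrow> (int \<Rightarrow> 'b)) \<Rightarrow> (int \<Rightarrow> 'a) set \<Rightarrow> bool" where
  "lifting n k w f X \<longleftrightarrow> (\<forall>x\<in>X. \<forall>y\<in>f ` X. \<forall>a.
     occurs n w a (f x) \<and> occurs n w a y \<longrightarrow> (\<exists>x'\<in>X. f x' = y \<and> agree (a - k) (a + k) x' x))"

lemma resolvingD:
  assumes "resolving n k w f X" "x \<in> X" "x' \<in> X" "a \<le> b" "occurs n w a (f x)" "occurs n w b (f x)"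
    "agree (a - n) (b + n) (f x) (f x')" "agree (a - k) (a + k) x x'"
  shows "agree (a - k) (b + k) x x'"
  using assms(1)[unfolded resolving_def, rule_format, OF assms(2,3), of a b] assms(4-) by simp

lemma liftingD:
  assumes "lifting n k w f X" "x \<in> X" "y \<in> f ` X" "occurs n w a (f x)" "occurs n w a y"
  obtains x' where "x' \<in> X" "f x' = y" "agree (a - k) (a + k) x' x"
  using assms(1)[unfolded lifting_def, rule_format, OF assms(2,3), of a] assms(4-) by blast

lemma occurs_block: "occurs n w a y \<longleftrightarrow> block (translate a y) (- n) n = block w (- n) n"
  by (simp add: occurs_shift_agree block_eq_iff)

text \<open>
The unique block in the definition of hyperbolicity is common to both preimages that are compared. Only
occurrences at the origin are mentioned there; translating the points gives all others.
\<close>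

lemma hyperbolic_imp_resolving_lifting:
  assumes "hyperbolic f X Y"
  obtains n k w where "0 \<le> n" "0 \<le> k" "w \<in> Y" "resolving n k w f X" "lifting n k w f X"
proof -
  obtain d n k W m where tr: "transitive_subshift X" "transitive_subshift Y" and fm: "factor_map f X Y"
    and W: "W \<in> blocks (2 * n + 1) Y"
    and 1: "\<forall>y\<in>Y. block y (- int n) (int n) = W \<longrightarrow>
           {block x (- int k) (int k) | x. x \<in> X \<and> f x = y} = m ` {1..d::nat}"
    and 2: "\<forall>w'\<in>language Y. \<forall>p::nat.
           prefix W w' \<and> suffix W w' \<and> length w' = 2 * n + 1 + p \<longrightarrow>
           (\<forall>i\<in>{1..d}. \<exists>!a. a \<in> language X \<and>
              (\<forall>x\<in>X. block (f x) (- int n) (int n + int p) = w' \<and>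
                      block x (- int k) (int k) = m i \<longrightarrow>
                      block x (- int k) (int k + int p) = a))"
    using assms unfolding hyperbolic_def by (elim conjE exE) (rule that)
  have X: "subshift X" and Y: "subshift Y" using tr by (simp_all add: transitive_subshift_def)
  note one = 1[rule_format]
  have two: "\<exists>!a. a \<in> language X \<and>
              (\<forall>x\<in>X. block (f x) (- int n) (int n + int p) = w' \<and>
                      block x (- int k) (int k) = m i \<longrightarrow>
                      block x (- int k) (int k + int p) = a)"
    if "w' \<in> language Y" "prefix W w'" "suffix W w'" "length w' = 2 * n + 1 + p" "i \<in> {1..d}" for w' p i
    using bspec[OF 2[THEN bspec, THEN spec, THEN mp, OF that(1) conjI[OF that(2) conjI[OF that(3,4)]]] that(5)] .
  obtain r where r: "sliding r f X" and fX: "f ` X = Y" using fm unfolding factor_map_iff_sliding by (elim conjE exE)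
  obtain y i where y: "y \<in> Y" "W = block y i (i + int (2 * n + 1) - 1)"
    using W unfolding blocks_def by blast
  define w where "w = translate (i + int n) y"
  have w: "w \<in> Y" unfolding w_def using y Y by (simp add: subshift_translate)
  have wW: "block w (- int n) (int n) = W"
    unfolding w_def block_translate y(2) by (simp add: algebra_simps)
  have lift: "lifting n k w f X" unfolding lifting_def
  proof (intro ballI allI impI)
    fix x y a assume x: "x \<in> X" and y: "y \<in> f ` X" and occ: "occurs n w a (f x) \<and> occurs n w a y"
    have tx: "translate a x \<in> X" "f (translate a x) = translate a (f x)"
      using x X subshift_translate sliding_translate[OF r] by auto
    have "block (translate a x) (- int k) (int k) \<in> m ` {1..d}"
      using one[of "translate a (f x)"] occ tx fX unfolding occurs_block wW by force
    moreover have "m ` {1..d} = {block x (- int k) (int k) | x. x \<in> X \<and> f x = translate a y}"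
      using one[of "translate a y"] occ y fX subshift_translate[OF Y] unfolding occurs_block wW by blast
    ultimately obtain x2 where x2: "x2 \<in> X" "f x2 = translate a y"
      "block (translate a x) (- int k) (int k) = block x2 (- int k) (int k)" by blast
    have "translate (- a) x2 \<in> X" "f (translate (- a) x2) = y"
      using x2 X subshift_translate sliding_translate[OF r] by auto
    moreover have "agree (a - k) (a + k) (translate (- a) x2) x"
      using x2(3) agree_translate[of "- int k" "int k" a "translate (- a) x2" x]
      by (simp add: block_eq_iff agree_sym add.commute)
    ultimately show "\<exists>x'\<in>X. f x' = y \<and> agree (a - k) (a + k) x' x" by blast
  qed
  have "resolving n k w f X" unfolding resolving_def
  proof (intro ballI allI impI, elim conjE)
    fix x x' a b assume x: "x \<in> X" and x': "x' \<in> X" and ab: "a \<le> b" and occ: "occurs n w a (f x)" "occurs n w b (f x)"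
      and ag: "agree (a - n) (b + n) (f x) (f x')" "agree (a - k) (a + k) x x'"
    define p where "p = nat (b - a)"
    have p: "b = a + int p" using ab by (simp add: p_def)
    let ?x = "translate a x" and ?x' = "translate a x'"
    have tx: "?x \<in> X" "f ?x = translate a (f x)" "?x' \<in> X" "f ?x' = translate a (f x')"
      using x x' X subshift_translate sliding_translate[OF r] by auto
    define w' where "w' = block (f ?x) (- int n) (int n + int p)"
    have w': "w' \<in> language Y" unfolding w'_def using imageI[OF tx(1), of f] fX by (intro block_in_language) simp
    have "w' = W @ block (f ?x) (int n + 1) (int n + int p)"
      unfolding w'_def using block_append[of "- int n" "int n" "int n + int p" "f ?x"] occ(1) tx
      unfolding occurs_block wW by simp
    then have pre: "prefix W w'" by simp
    have "block (f ?x) (int p - int n) (int n + int p) = W"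
      using occ(2) tx unfolding occurs_block wW p by (simp add: block_translate algebra_simps)
    then have "w' = block (f ?x) (- int n) (int p - int n - 1) @ W"
      unfolding w'_def using block_append[of "- int n" "int p - int n - 1" "int n + int p" "f ?x"] by simp
    then have suf: "suffix W w'" unfolding suffix_def by blast
    have len: "length w' = 2 * n + 1 + p" unfolding w'_def by (simp add: length_block)
    have "block ?x (- int k) (int k) \<in> m ` {1..d}"
      using one[of "translate a (f x)"] occ tx fX unfolding occurs_block wW by force
    then obtain i where i: "i \<in> {1..d}" "block ?x (- int k) (int k) = m i" by blast
    from two[OF w' pre suf len i(1)] obtain c where
      c: "\<And>x. x \<in> X \<Longrightarrow> block (f x) (- int n) (int n + int p) = w' \<Longrightarrow>
              block x (- int k) (int k) = m i \<Longrightarrow> block x (- int k) (int k + int p) = c"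
      by blast
    have "block ?x' (- int k) (int k) = m i"
      using ag(2) i(2) agree_sym by (simp add: block_eq_iff flip: i(2)) (simp add: agree_sym add.commute)
    moreover have "block (f ?x') (- int n) (int n + int p) = w'"
      unfolding w'_def block_eq_iff using ag(1) tx by (simp add: agree_sym p algebra_simps)
    ultimately have "block ?x (- int k) (int k + int p) = block ?x' (- int k) (int k + int p)"
      using c[OF tx(1)] c[OF tx(3)] i(2) w'_def by simp
    then show "agree (a - int k) (b + int k) x x'"
      by (simp add: block_eq_iff p algebra_simps)
  qed
  then show thesis using that lift w by (metis of_nat_0_le_iff)
qed

lemma finite_subshift_blocks:
  assumes "subshift X"
  shows "finite {block x a b | x. x \<in> X}"
proof -
  obtain A where A: "finite A" "X \<subseteq> {x. range x \<subseteq> A}" using assms by (rule subshift_alphabet)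
  have "x i \<in> A" if "x \<in> X" for x i using that A(2) by auto
  then have "{block x a b | x. x \<in> X} \<subseteq> {u. set u \<subseteq> A \<and> length u = nat (b - a + 1)}"
    by (auto simp: block_def)
  then show ?thesis using finite_lists_length_eq[OF A(1)] finite_subset by blast
qed

lemma resolving_larger_window:
  assumes "resolving n k w f X" "n \<le> n'" "occurs n w 0 w'"
  shows "resolving n' k w' f X"
  unfolding resolving_def
proof (intro ballI allI impI, elim conjE)
  fix x x' a b assume x: "x \<in> X" "x' \<in> X" and ab: "a \<le> b" and occ: "occurs n' w' a (f x)" "occurs n' w' b (f x)"
      and ag: "agree (a - n') (b + n') (f x) (f x')" "agree (a - k) (a + k) x x'"
  have "occurs n w a (f x)" "occurs n w b (f x)"
    using occurs_comp[OF occ(1) assms(3)] occurs_comp[OF occ(2) assms(3)] assms(2) by auto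
  then show "agree (a - k) (b + k) x x'"
    using resolvingD[OF assms(1) x ab] agree_mono[OF ag(1)] ag(2) assms(2) by simp
qed

text \<open>
Enlarging the pattern can only shrink the set of central blocks above it. Once this set has minimal
cardinality it is the same for all larger patterns, in particular for longer and longer windows of a
point \<open>y\<close> that shows the pattern. A block in it thus has preimages that map to \<open>y\<close> on longer and
longer windows, and an accumulation point of them lies in the fibre of \<open>y\<close>.
\<close>

lemma resolving_imp_lifting:
  assumes X: "subshift X" and r: "sliding r f X" and w: "w \<in> f ` X" and res: "resolving n k w f X" and n: "0 \<le> n"
  obtains n' w' where "n \<le> n'" "w' \<in> f ` X" "resolving n' k w' f X" "lifting n' k w' f X"
proof -
  define T where "T N y = {block x (- k) k | x. x \<in> X \<and> occurs N y 0 (f x)}" for N y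
  have fin: "finite (T N y)" for N y
    using finite_subshift_blocks[OF X, of "-k" k] by (rule finite_subset[rotated]) (auto simp: T_def)
  \<comment> \<open>A pair \<open>(N, y)\<close> stands for a pattern that extends the given word; one with the fewest blocks is chosen.\<close>
  define P where "P = (\<lambda>(N, y). n \<le> N \<and> y \<in> f ` X \<and> occurs n w 0 y)"
  have "P (n, w)" using w by (simp add: P_def occurs_self)
  then have "\<exists>M. P M \<and> (\<forall>M'. P M' \<longrightarrow> card (T (fst M) (snd M)) \<le> card (T (fst M') (snd M')))"
    by (rule ex_has_least_nat)
  then obtain Ny where Ny: "P Ny" "\<And>M. P M \<Longrightarrow> card (T (fst Ny) (snd Ny)) \<le> card (T (fst M) (snd M))"
    by auto
  obtain N w' where Nw: "Ny = (N, w')" by (cases Ny)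
  have min: "n \<le> N" "w' \<in> f ` X" "occurs n w 0 w'" using Ny(1) by (simp_all add: Nw P_def)
  have least: "card (T N w') \<le> card (T N' y)" if "n \<le> N'" "y \<in> f ` X" "occurs n w 0 y" for N' y
    using Ny(2)[of "(N', y)"] that by (simp add: Nw P_def)
  have same: "T N' y = T N w'" if "y \<in> f ` X" "occurs N w' 0 y" "N \<le> N'" for N' y
  proof (rule card_subset_eq[OF fin])
    have "occurs N w' 0 z" if "occurs N' y 0 z" for z
      using occurs_comp[OF occurs_mono[OF that \<open>N \<le> N'\<close>] \<open>occurs N w' 0 y\<close>] by simp
    then show "T N' y \<subseteq> T N w'" unfolding T_def by blast
    moreover have "occurs n w 0 y" using occurs_comp[OF that(2) min(3)] min(1) by simp
    ultimately show "card (T N' y) = card (T N w')"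
      using least[of N' y] min(1) that card_mono[OF fin] by (simp add: le_antisym)
  qed
  have "lifting N k w' f X" unfolding lifting_def
  proof (intro ballI allI impI, elim conjE)
    fix x y a assume x: "x \<in> X" and y: "y \<in> f ` X" and occ: "occurs N w' a (f x)" "occurs N w' a y"
    let ?x = "translate a x" and ?y = "translate a y"
    have tx: "?x \<in> X" "f ?x = translate a (f x)"
      using x X subshift_translate sliding_translate[OF r] by auto
    obtain z where z: "z \<in> X" "y = f z" using y by blast
    have ty: "?y \<in> f ` X"
      unfolding z(2) sliding_translate[OF r X z(1), symmetric] using subshift_translate[OF X z(1)] by (rule imageI)
    have "\<exists>u\<in>X. block u (- k) k = block ?x (- k) k \<and> occurs (N + int j) ?y 0 (f u)" for j
    proof -
      have "block ?x (- k) k \<in> T N w'" unfolding T_def using tx occ(1) by auto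
      then have "block ?x (- k) k \<in> T (N + int j) ?y" using same[OF ty, of "N + int j"] occ(2) by simp
      then show ?thesis unfolding T_def by auto
    qed
    then obtain s where s: "\<And>j. s j \<in> X" "\<And>j. block (s j) (- k) k = block ?x (- k) k"
      "\<And>j. occurs (N + int j) ?y 0 (f (s j))" by metis
    obtain u where u: "u \<in> X" "\<And>K M. \<exists>j\<ge>M. agree (- K) K (s j) u"
      by (rule subshift_accumulation_point[OF X s(1)]) (rule that)
    have "f u i = ?y i" for i
    proof -
      obtain j where j: "j \<ge> nat \<bar>i\<bar>" "agree (- \<bar>i\<bar> - r) (\<bar>i\<bar> + r) (s j) u"
        using u(2)[where M = "nat \<bar>i\<bar>" and K = "\<bar>i\<bar> + r"] by (elim exE conjE) (rule that, simp_all)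
      have "agree (- \<bar>i\<bar>) \<bar>i\<bar> (f (s j)) (f u)"
        using j(2) by (rule sliding_agree[OF r s(1) u(1)])
      then have "f (s j) i = f u i" by (rule agreeD) auto
      moreover have "f (s j) i = ?y i" using occursD[OF s(3)[of j], of i] j(1) min(1) n by simp
      ultimately show ?thesis by simp
    qed
    then have fu: "f u = ?y" by blast
    obtain j where "agree (- k) k (s j) u" using u(2) by blast
    then have "agree (- k) k u ?x" using s(2)[of j] agree_trans agree_sym unfolding block_eq_iff by blast
    then have "agree (a - k) (a + k) (translate (- a) u) x"
      using agree_translate[of "- k" k a "translate (- a) u" x] by (simp add: add.commute)
    moreover have "translate (- a) u \<in> X" "f (translate (- a) u) = y"
      using u(1) X subshift_translate sliding_translate[OF r] fu by auto
    ultimately show "\<exists>x'\<in>X. f x' = y \<and> agree (a - k) (a + k) x' x" by blast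
  qed
  then show thesis using that[OF min(1,2)] resolving_larger_window[OF res min(1,3)] by blast
qed

text \<open>
Numbers the finitely many central blocks above a pattern that has the lifting property. The block \<open>a\<close>
required for a word \<open>w'\<close> is read off a lift of a point showing \<open>w'\<close>; its uniqueness
in the definition needs the existence of such a lift, since a condition on no point at all would
be satisfied by every block.
\<close>

lemma hyperbolic_if_resolving:
  assumes X: "transitive_subshift X" and Y: "transitive_subshift Y" and f: "factor_map f X Y"
    and w: "w \<in> Y" and res: "resolving n k w f X" and n: "0 \<le> n" and k: "0 \<le> k"
  shows "hyperbolic f X Y"
proof -
  have sX: "subshift X" and sY: "subshift Y" using X Y unfolding transitive_subshift_def by auto
  obtain r where r: "sliding r f X" and fX: "f ` X = Y" using f unfolding factor_map_iff_sliding by (elim conjE exE)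
  obtain n0 w where n0: "n \<le> n0" "w \<in> Y" "resolving n0 k w f X" "lifting n0 k w f X"
    using resolving_imp_lifting[OF sX r _ res n] w fX by metis
  obtain N K :: nat where NK: "n0 = int N" "k = int K" using n n0(1) k by (metis nonneg_int_cases order_trans)
  define T where "T = {block x (- k) k | x. x \<in> X \<and> occurs n0 w 0 (f x)}"
  have "finite T" using finite_subshift_blocks[OF sX, of "-k" k] by (rule finite_subset[rotated]) (auto simp: T_def)
  then obtain m where m: "bij_betw m {1..card T} T" using ex_bij_betw_nat_finite_1 by blast
  then have mT: "m ` {1..card T} = T" by (simp add: bij_betw_def)
  define W where "W = block w (- n0) n0"
  have W: "block y (- n0) n0 = W \<longleftrightarrow> occurs n0 w 0 y" for y
    using occurs_block[of n0 w 0 y] by (simp add: W_def)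
  have lenW: "length W = 2 * N + 1" by (simp add: W_def length_block NK)
  have one: "{block x (- k) k | x. x \<in> X \<and> f x = y} = T" if y: "y \<in> Y" "block y (- n0) n0 = W" for y
  proof
    show "T \<subseteq> {block x (- k) k | x. x \<in> X \<and> f x = y}"
    proof
      fix b assume "b \<in> T"
      then obtain x where x: "x \<in> X" "occurs n0 w 0 (f x)" "b = block x (- k) k" unfolding T_def by blast
      then obtain x' where "x' \<in> X" "f x' = y" "agree (0 - k) (0 + k) x' x"
        using liftingD[OF n0(4) x(1) _ x(2)] y fX W by metis
      then show "b \<in> {block x (- k) k | x. x \<in> X \<and> f x = y}"
        using x(3) block_eq_iff[of x' "-k" k x] by (intro CollectI exI[of _ x']) auto
    qed
  qed (use y W T_def in auto)
  have two: "\<exists>!a. a \<in> language X \<and>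
              (\<forall>x\<in>X. block (f x) (- n0) (n0 + int p) = w' \<and>
                      block x (- k) k = t \<longrightarrow>
                      block x (- k) (k + int p) = a)"
    if w': "w' \<in> language Y" "prefix W w'" "suffix W w'" "length w' = 2 * N + 1 + p" and t: "t \<in> T" for w' t and p :: nat
  proof -
    obtain y where y: "y \<in> Y" and yw: "w' = block y (- n0) (- n0 + int (length w') - 1)"
      using in_language_iff[OF sY, THEN iffD1, OF w'(1), of "- n0"] by (rule bexE)
    have "- n0 + int (length w') - 1 = n0 + int p" by (simp add: w'(4) NK)
    from yw[unfolded this] have yw: "w' = block y (- n0) (n0 + int p)" .
    obtain v where "w' = W @ v" using w'(2) prefix_def by blast
    then have "W = block y (- n0) n0"
      using block_eq_appendD[of y "- n0" "n0 + int p" W v] yw lenW NK by simp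
    then have occ1: "occurs n0 w 0 y" using W by blast
    obtain v where v: "w' = v @ W" using w'(3) suffix_def by blast
    then have "length v = p" using w'(4) lenW by simp
    then have "W = block y (- n0 + int p) (n0 + int p)"
      using block_eq_appendD[of y "- n0" "n0 + int p" v W] yw v by simp
    then have occ2: "occurs n0 w (int p) y"
      unfolding occurs_block W_def by (simp add: block_translate)
    obtain x0 where x0: "x0 \<in> X" "occurs n0 w 0 (f x0)" "t = block x0 (- k) k"
      using t unfolding T_def by blast
    obtain x1 where x1: "x1 \<in> X" "f x1 = y" "agree (0 - k) (0 + k) x1 x0"
      using liftingD[OF n0(4) x0(1) _ x0(2) occ1] y fX by metis
    have t1: "block x1 (- k) k = t" using x1(3) unfolding x0(3) block_eq_iff by simp
    have uni: "block x (- k) (k + int p) = block x1 (- k) (k + int p)"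
      if x: "x \<in> X" "block (f x) (- n0) (n0 + int p) = w'" "block x (- k) k = t" for x
    proof -
      have "agree (0 - n0) (int p + n0) (f x1) (f x)"
        using x(2)[symmetric] unfolding yw x1(2) block_eq_iff by (simp add: add.commute)
      moreover have "agree (0 - k) (0 + k) x1 x"
        using t1 unfolding x(3)[symmetric] block_eq_iff by simp
      ultimately have "agree (0 - k) (int p + k) x1 x"
        using resolvingD[OF n0(3) x1(1) x(1), of 0 "int p"] occ1 occ2 x1(2) by simp
      then show ?thesis unfolding block_eq_iff by (simp add: agree_sym add.commute)
    qed
    have x1w: "block (f x1) (- n0) (n0 + int p) = w'" unfolding x1(2) by (rule yw[symmetric])
    show ?thesis
    proof (rule ex1I[of _ "block x1 (- k) (k + int p)"])
      show "block x1 (- k) (k + int p) \<in> language X \<and>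
              (\<forall>x\<in>X. block (f x) (- n0) (n0 + int p) = w' \<and> block x (- k) k = t \<longrightarrow>
                      block x (- k) (k + int p) = block x1 (- k) (k + int p))"
        using uni block_in_language[OF x1(1)] by blast
    qed (use x1(1) x1w t1 in blast)
  qed
  have "W \<in> blocks (2 * N + 1) Y"
    unfolding blocks_def W_def using n0(2) NK by (intro CollectI exI[of _ w] exI[of _ "- n0"]) simp
  moreover have "\<forall>i\<in>{1..card T}. m i \<in> blocks (2 * K + 1) X"
  proof
    fix i assume "i \<in> {1..card T}"
    then have "m i \<in> T" using mT by blast
    then obtain x where x: "x \<in> X" "m i = block x (- k) k" unfolding T_def by blast
    then show "m i \<in> blocks (2 * K + 1) X"
      unfolding blocks_def using NK by (intro CollectI exI[of _ x] exI[of _ "- k"]) simp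
  qed
  moreover have "\<forall>y\<in>Y. block y (- int N) (int N) = W \<longrightarrow>
      {block x (- int K) (int K) | x. x \<in> X \<and> f x = y} = m ` {1..card T}"
    using one unfolding mT NK by simp
  moreover have "\<forall>w'\<in>language Y. \<forall>p::nat.
      prefix W w' \<and> suffix W w' \<and> length w' = 2 * N + 1 + p \<longrightarrow>
      (\<forall>i\<in>{1..card T}. \<exists>!a. a \<in> language X \<and>
        (\<forall>x\<in>X. block (f x) (- int N) (int N + int p) = w' \<and> block x (- int K) (int K) = m i \<longrightarrow>
          block x (- int K) (int K + int p) = a))"
  proof (intro ballI allI impI, elim conjE)
    fix w' p i assume "w' \<in> language Y" "prefix W w'" "suffix W w'" "length w' = 2 * N + 1 + p" "i \<in> {1..card T}"
    moreover from this have "m i \<in> T" using mT by blast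
    ultimately show "\<exists>!a. a \<in> language X \<and>
        (\<forall>x\<in>X. block (f x) (- int N) (int N + int p) = w' \<and> block x (- int K) (int K) = m i \<longrightarrow>
          block x (- int K) (int K + int p) = a)"
      using two[unfolded NK] by simp
  qed
  ultimately show ?thesis
    unfolding hyperbolic_def using X Y f
    by (intro conjI exI[of _ "card T"] exI[of _ N] exI[of _ K] exI[of _ W] exI[of _ m])
qed

text \<open>
On the fibre of a point with the word at \<open>a\<close> and at \<open>b\<close>, the central block at \<open>a\<close> determines the one at
\<open>b\<close>. By lifting, the blocks at \<open>a\<close> and those at \<open>b\<close> range over the same finite set, so this assignment
is a surjection of a finite set onto itself, hence injective: the block at \<open>b\<close> also determines
the one at \<open>a\<close>.
\<close>

lemma resolving_backwards:
  assumes X: "subshift X" and r: "sliding r f X" and res: "resolving n k w f X" and lift: "lifting n k w f X"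
    and x: "x \<in> X" and x': "x' \<in> X" and ab: "a \<le> b"
    and occ: "occurs n w a (f x)" "occurs n w b (f x)"
    and ag: "agree (a - n) (b + n) (f x) (f x')" and agb: "agree (b - k) (b + k) x x'" and nk: "0 \<le> n" "0 \<le> k"
  shows "agree (a - k) (b + k) x x'"
proof -
  define F where "F = {u \<in> X. f u = f x}"
  define A where "A u = block u (a - k) (a + k)" for u :: "int \<Rightarrow> 'a"
  define B where "B u = block u (b - k) (b + k)" for u :: "int \<Rightarrow> 'a"
  have fwd: "B u = B u'" if "u \<in> F" "u' \<in> X" "A u = A u'" "agree (a - n) (b + n) (f x) (f u')" for u u'
  proof -
    have "u \<in> X" "f u = f x" using that(1) by (simp_all add: F_def)
    moreover have "agree (a - k) (a + k) u u'" using that(3) by (simp add: A_def block_eq_iff)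
    ultimately have "agree (a - k) (b + k) u u'"
      using resolvingD[OF res _ that(2) ab, of u] occ that(4) by simp
    then show ?thesis unfolding B_def block_eq_iff by (rule agree_mono) (use ab in auto)
  qed
  \<comment> \<open>Translating a point of the fibre by \<open>b - a\<close> moves its block at \<open>b\<close> to \<open>a\<close>, from where it can be lifted.\<close>
  have B_in_A: "B ` F \<subseteq> A ` F"
  proof clarify
    fix u assume u: "u \<in> F"
    let ?u = "translate (b - a) u"
    have tu: "?u \<in> X" "f ?u = translate (b - a) (f x)"
      using u X subshift_translate sliding_translate[OF r] by (auto simp: F_def)
    have "occurs n w a (f ?u)" using tu occ(2) by simp
    then obtain u' where "u' \<in> X" "f u' = f x" "agree (a - k) (a + k) u' ?u"
      using liftingD[OF lift tu(1) imageI[OF x], of a] occ by blast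
    then have "u' \<in> F" "A u' = A ?u" by (auto simp: F_def A_def block_eq_iff)
    moreover have "A ?u = B u" by (simp add: A_def B_def block_translate algebra_simps)
    ultimately show "B u \<in> A ` F" by force
  qed
  have A_in_B: "A ` F \<subseteq> B ` F"
  proof clarify
    fix u assume u: "u \<in> F"
    let ?u = "translate (a - b) u"
    have tu: "?u \<in> X" "f ?u = translate (a - b) (f x)"
      using u X subshift_translate sliding_translate[OF r] by (auto simp: F_def)
    have "occurs n w b (f ?u)" using tu occ(1) by simp
    then obtain u' where "u' \<in> X" "f u' = f x" "agree (b - k) (b + k) u' ?u"
      using liftingD[OF lift tu(1) imageI[OF x], of b] occ by blast
    then have "u' \<in> F" "B u' = B ?u" by (auto simp: F_def B_def block_eq_iff)
    moreover have "B ?u = A u" by (simp add: A_def B_def block_translate algebra_simps)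
    ultimately show "A u \<in> B ` F" by force
  qed
  have fin: "finite (A ` F)"
    using finite_subshift_blocks[OF X, of "a - k" "a + k"] by (rule finite_subset[rotated]) (auto simp: A_def F_def)
  define \<psi> where "\<psi> t = B (SOME u. u \<in> F \<and> A u = t)" for t
  have \<psi>: "\<psi> (A u) = B u" if "u \<in> F" for u
  proof -
    define v where "v = (SOME u'. u' \<in> F \<and> A u' = A u)"
    have "v \<in> F \<and> A v = A u"
      unfolding v_def by (rule someI[where P = "\<lambda>u'. u' \<in> F \<and> A u' = A u" and x = u]) (use that in simp)
    moreover have "u \<in> X" "f u = f x" using that by (simp_all add: F_def)
    moreover have "agree (a - n) (b + n) (f x) (f x)" by (simp add: agree_def)
    ultimately have "B v = B u" using fwd[of v u] by simp
    then show ?thesis unfolding \<psi>_def v_def .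
  qed
  have "\<psi> ` (A ` F) = B ` F" unfolding image_image by (rule image_cong[OF refl]) (rule \<psi>)
  then have inj: "inj_on \<psi> (A ` F)" using finite_surj_inj[OF fin, of \<psi>] A_in_B by simp
  have fx': "f x' \<in> f ` X" "occurs n w a (f x')" using x' occurs_agree[OF occ(1) ag] ab nk by auto
  obtain u where u: "u \<in> X" "f u = f x" "agree (a - k) (a + k) u x'"
    using liftingD[OF lift x' imageI[OF x] fx'(2) occ(1)] by blast
  have uF: "u \<in> F" and xF: "x \<in> F" using u x by (auto simp: F_def)
  have Au: "A u = A x'" using u(3) by (simp add: A_def block_eq_iff)
  then have "B u = B x'" using fwd[OF uF x'] ag by blast
  also have "\<dots> = B x" using agb by (simp add: B_def block_eq_iff agree_sym)
  finally have "\<psi> (A u) = \<psi> (A x)" using \<psi> uF xF by simp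
  then have "A u = A x" using inj uF xF by (auto dest: inj_onD)
  then have "agree (a - k) (a + k) x x'" using Au by (simp add: A_def flip: block_eq_iff)
  then show ?thesis using resolvingD[OF res x x' ab occ ag] by blast
qed

lemma hyperbolicD:
  assumes "hyperbolic f X Y"
  shows "transitive_subshift X" "transitive_subshift Y" "factor_map f X Y"
  using assms[unfolded hyperbolic_def, THEN conjunct1]
    assms[unfolded hyperbolic_def, THEN conjunct2, THEN conjunct1]
    assms[unfolded hyperbolic_def, THEN conjunct2, THEN conjunct2, THEN conjunct1] .

section \<open>Forcing a pattern in every preimage\<close>

text \<open>
By induction over sets of central blocks. To treat one more block, take the lift of the pattern found
so far with this central block, extend it inside \<open>X\<close> until it shows \<open>x1\<close> and afterwards the
word again, and use the image of the extension as the new pattern. By determinism every preimage of the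
new pattern starting with the new block follows this extension and shows \<open>x1\<close>; preimages
starting with one of the other blocks are handled by the part of the pattern already there.
\<close>

lemma every_lift_visits:
  fixes x1 :: "int \<Rightarrow> 'a"
  assumes X: "transitive_subshift X" and r: "sliding r f X" and res: "resolving n k w f X"
    and lift: "lifting n k w f X" and w: "w \<in> f ` X" and nk: "0 \<le> n" "0 \<le> k" and x1: "x1 \<in> X"
  obtains y N Q where "y \<in> f ` X" "\<And>x. x \<in> X \<Longrightarrow> occurs N y 0 (f x) \<Longrightarrow> \<exists>q. \<bar>q\<bar> \<le> Q \<and> occurs K x1 q x"
proof -
  have sX: "subshift X" using X unfolding transitive_subshift_def by blast
  define T where "T = {block x (- k) k | x. x \<in> X \<and> occurs n w 0 (f x)}"
  have fin: "finite T" using finite_subshift_blocks[OF sX, of "-k" k] by (rule finite_subset[rotated]) (auto simp: T_def)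
  have visits: "\<exists>y\<in>f ` X. \<exists>N\<ge>n. \<exists>Q. occurs n w 0 y \<and>
     (\<forall>x\<in>X. occurs N y 0 (f x) \<and> block x (- k) k \<in> S \<longrightarrow> (\<exists>q. \<bar>q\<bar> \<le> Q \<and> occurs K x1 q x))"
    if "finite S" "S \<subseteq> T" for S
    using that
  proof (induction S rule: finite_induct)
    case empty
    then show ?case using w occurs_self[of n w] by (intro bexI[of _ w] exI[of _ n]) auto
  next
    case (insert t S)
    then obtain y N Q where y: "y \<in> f ` X" "n \<le> N" "occurs n w 0 y"
      and IH: "\<And>x. x \<in> X \<Longrightarrow> occurs N y 0 (f x) \<Longrightarrow> block x (- k) k \<in> S \<Longrightarrow> \<exists>q. \<bar>q\<bar> \<le> Q \<and> occurs K x1 q x"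
      by blast
    obtain x0 where x0: "x0 \<in> X" "occurs n w 0 (f x0)" "t = block x0 (- k) k"
      using insert.prems unfolding T_def by blast
    obtain u where u: "u \<in> X" "f u = y" "agree (0 - k) (0 + k) u x0"
      using liftingD[OF lift x0(1) y(1) x0(2) y(3)] by blast
    obtain z1 q where z1: "z1 \<in> X" "\<bar>K\<bar> \<le> q" "occurs (N + r + k) u 0 z1" "occurs K x1 q z1"
      using transitive_two_patterns[OF X u(1) x1] by blast
    define M where "M = N + r + k + q + \<bar>K\<bar>"
    obtain z2 s where z2: "z2 \<in> X" "q + \<bar>K\<bar> \<le> s" "occurs M z1 0 z2" "occurs (N + r) u s z2"
      using transitive_two_patterns[OF X z1(1) u(1)] by blast
    have r0: "0 \<le> r" using r by (simp add: sliding_def)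
    have zu: "occurs (N + r + k) u 0 z2"
      using occurs_comp[OF z2(3) z1(3)] z1(2) y(2) nk r0 by (simp add: M_def)
    have zx: "occurs K x1 q z2"
      using occurs_comp[OF z2(3) z1(4)] z1(2) y(2) nk r0 by (simp add: M_def)
    have fz: "occurs N y 0 (f z2)"
      using sliding_occurs[OF r sX z2(1) u(1) occurs_mono[OF zu]] nk u(2) by simp
    have fz0: "occurs n w 0 (f z2)" using occurs_comp[OF fz y(3)] y(2) by simp
    have fzs: "occurs n w s (f z2)"
      using occurs_comp[OF sliding_occurs[OF r sX z2(1) u(1) z2(4)], of n w 0] y(2,3) u(2) by simp
    define N' where "N' = N + s + n"
    have s0: "0 \<le> s" using z2(2) z1(2) by linarith
    have main: "\<exists>q'. \<bar>q'\<bar> \<le> max Q q \<and> occurs K x1 q' x"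
      if x: "x \<in> X" "occurs N' (f z2) 0 (f x)" "block x (- k) k \<in> insert t S" for x
    proof (cases "block x (- k) k = t")
      case True
      have "agree (- k) k x x0" using True unfolding x0(3) block_eq_iff .
      moreover have "agree (- k) k z2 u"
        using occurs_mono[OF zu, of k] y(2) nk r0 unfolding occurs_eq_agree by simp
      ultimately have "agree (0 - k) (0 + k) z2 x"
        using u(3) by (simp add: agree_def)
      moreover have "agree (0 - n) (s + n) (f z2) (f x)"
        using x(2) unfolding occurs_eq_agree
        by (rule agree_sym[OF agree_mono]) (use y(2) nk s0 in \<open>auto simp: N'_def\<close>)
      ultimately have "agree (0 - k) (s + k) z2 x"
        using resolvingD[OF res z2(1) x(1) s0 fz0 fzs] by blast
      then have "occurs K x1 q x"
        using occurs_agree[OF zx] z1(2) z2(2) nk by simp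
      then show ?thesis using z1(2) by (intro exI[of _ q]) simp
    next
      case False
      have "occurs N y 0 (f x)" using occurs_comp[OF x(2) fz] s0 nk by (simp add: N'_def)
      then obtain q' where "\<bar>q'\<bar> \<le> Q" "occurs K x1 q' x" using IH[OF x(1)] x(3) False by blast
      then show ?thesis by (intro exI[of _ q']) simp
    qed
    have "n \<le> N'" using s0 nk y(2) by (simp add: N'_def)
    then show ?case using z2(1) fz0 main by blast
  qed
  obtain y N Q where y: "y \<in> f ` X" "n \<le> N" "occurs n w 0 y"
    and v: "\<And>x. x \<in> X \<Longrightarrow> occurs N y 0 (f x) \<Longrightarrow> block x (- k) k \<in> T \<Longrightarrow> \<exists>q. \<bar>q\<bar> \<le> Q \<and> occurs K x1 q x"
    using visits[OF fin subset_refl] by blast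
  show thesis
  proof (rule that[OF y(1), of N Q])
    fix x assume x: "x \<in> X" "occurs N y 0 (f x)"
    have "occurs n w 0 (f x)" using occurs_comp[OF x(2) y(3)] y(2) by simp
    then show "\<exists>q. \<bar>q\<bar> \<le> Q \<and> occurs K x1 q x" using v[OF x] x(1) T_def by blast
  qed
qed

section \<open>Composition\<close>

lemma sliding_compose:
  assumes f: "sliding r f X" and g: "sliding s g (f ` X)" and X: "subshift X"
  shows "sliding (r + s) (\<lambda>x. g (f x)) X"
  unfolding sliding_def
proof (intro conjI ballI allI impI)
  show "0 \<le> r + s" using f g by (simp add: sliding_def)
  fix x x' i j assume x: "x \<in> X" "x' \<in> X" and ag: "agree (- (r + s)) (r + s) (translate i x) (translate j x')"
  from ag have "agree (- s - r) (s + r) (translate i x) (translate j x')"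
    by (rule agree_mono) simp_all
  then have "agree (- s) s (f (translate i x)) (f (translate j x'))"
    by (rule sliding_agree[OF f subshift_translate[OF X x(1)] subshift_translate[OF X x(2)]])
  then have "agree (- s) s (translate i (f x)) (translate j (f x'))"
    using sliding_translate[OF f X] x by simp
  then show "g (f x) i = g (f x') j" using g x unfolding sliding_def by blast
qed

lemma factor_map_compose:
  assumes "factor_map f X Y" "factor_map g Y Z" "subshift X"
  shows "factor_map (\<lambda>x. g (f x)) X Z"
proof -
  obtain r s where rs: "sliding r f X" "sliding s g Y" "f ` X = Y" "g ` Y = Z"
    using assms unfolding factor_map_iff_sliding by (elim conjE exE)
  then have "sliding (r + s) (\<lambda>x. g (f x)) X" using sliding_compose[OF rs(1) _ assms(3)] by simp
  moreover have "(\<lambda>x. g (f x)) ` X = Z" using rs(3,4) by (simp add: image_image[symmetric])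
  ultimately show ?thesis unfolding factor_map_iff_sliding by blast
qed

text \<open>
Let \<open>w\<close> be a word for \<open>f\<close>, \<open>z0\<close> one for \<open>g\<close>, and \<open>z1\<close> a pattern of \<open>Z\<close> all of whose lifts show \<open>w\<close>. The
word for the composition contains \<open>z0\<close>, \<open>z1\<close>, \<open>z1\<close>, \<open>z0\<close>, in this order and far apart: between the first
and the last \<open>z0\<close> the point of \<open>Y\<close> is determined, and between an occurrence of \<open>w\<close> above the first
\<open>z1\<close> and one above the second \<open>z1\<close> the point of \<open>X\<close> is determined. The exact positions of \<open>w\<close> vary with
the lift, but the central window of radius \<open>K\<close> contains the first of them and lies to the
left of the second.
\<close>

theorem hyperbolic_compose:
  assumes f: "hyperbolic f X Y" and g: "hyperbolic g Y Z"
  shows "hyperbolic (\<lambda>x. g (f x)) X Z"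
proof -
  have tr: "transitive_subshift X" "transitive_subshift Y" "transitive_subshift Z"
    and fm: "factor_map f X Y" "factor_map g Y Z"
    by (rule hyperbolicD[OF f] hyperbolicD[OF g])+
  have sub: "subshift X" "subshift Y" "subshift Z" using tr unfolding transitive_subshift_def by blast+
  obtain n k w where f: "0 \<le> n" "0 \<le> k" "w \<in> Y" "resolving n k w f X"
    using hyperbolic_imp_resolving_lifting[OF f] by metis
  obtain n' k' z0 where g: "0 \<le> n'" "0 \<le> k'" "z0 \<in> Z" "resolving n' k' z0 g Y" "lifting n' k' z0 g Y"
    using hyperbolic_imp_resolving_lifting[OF g] by metis
  obtain r where r: "sliding r f X" and fX: "f ` X = Y" using fm(1) unfolding factor_map_iff_sliding by (elim conjE exE)
  obtain s where s: "sliding s g Y" and gY: "g ` Y = Z" using fm(2) unfolding factor_map_iff_sliding by (elim conjE exE)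
  have r0: "0 \<le> r" using r by (simp add: sliding_def)
  obtain z1 N Q where z1: "z1 \<in> g ` Y"
    and visit0: "\<And>y. y \<in> Y \<Longrightarrow> occurs N z1 0 (g y) \<Longrightarrow> \<exists>q. \<bar>q\<bar> \<le> Q \<and> occurs n w q y"
    using every_lift_visits[OF tr(2) s g(4,5) _ g(1,2) f(3), of n] g(3) gY by metis
  have visit: "\<exists>q. \<bar>q\<bar> \<le> \<bar>Q\<bar> \<and> occurs n w (a + q) y" if "y \<in> Y" "occurs N z1 a (g y)" for a y
  proof -
    have "translate a y \<in> Y" "occurs N z1 0 (g (translate a y))"
      using that subshift_translate[OF sub(2)] sliding_translate[OF s sub(2)] by auto
    then obtain q where "\<bar>q\<bar> \<le> Q" "occurs n w q (translate a y)" using visit0 by blast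
    then show ?thesis by (intro exI[of _ q]) (auto simp: add.commute)
  qed
  have z1: "z1 \<in> Z" using z1 gY by simp
  obtain p1 c1 where p1: "p1 \<in> Z" "\<bar>Q\<bar> + n \<le> c1" "occurs n' z0 0 p1" "occurs N z1 c1 p1"
    using transitive_two_patterns[OF tr(3) g(3) z1] by blast
  \<comment> \<open>The radius covers the block needed for the first determinism in \<open>Y\<close> and the one at the first visit of \<open>w\<close>.\<close>
  define K where "K = k' + r + c1 + \<bar>Q\<bar> + k"
  define L1 where "L1 = c1 + \<bar>N\<bar> + n'"
  obtain p2 c2 where p2: "p2 \<in> Z" "K + \<bar>Q\<bar> \<le> c2" "occurs L1 p1 0 p2" "occurs N z1 c2 p2"
    using transitive_two_patterns[OF tr(3) p1(1) z1] by blast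
  define L2 where "L2 = L1 + c2 + \<bar>N\<bar>"
  obtain p3 e where p3: "p3 \<in> Z" "c2 + \<bar>Q\<bar> + n \<le> e" "occurs L2 p2 0 p3" "occurs n' z0 e p3"
    using transitive_two_patterns[OF tr(3) p2(1) g(3)] by blast
  define L3 where "L3 = L2 + e + n'"
  have pos: "0 \<le> c1" "0 \<le> K" "0 \<le> L1" "0 \<le> c2" "0 \<le> L2" "0 \<le> e" "0 \<le> L3"
    using f g p1(2) p2(2) p3(2) r0 by (auto simp: K_def L1_def L2_def L3_def)
  have p2': "occurs n' z0 0 p2" "occurs N z1 c1 p2"
    using occurs_comp[OF p2(3) p1(3)] occurs_comp[OF p2(3) p1(4)] pos g(1) by (auto simp: L1_def)
  have p3': "occurs n' z0 0 p3" "occurs N z1 c1 p3" "occurs N z1 c2 p3"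
    using occurs_comp[OF p3(3) p2'(1)] occurs_comp[OF p3(3) p2'(2)] occurs_comp[OF p3(3) p2(4)] pos g(1)
    by (auto simp: L1_def L2_def)
  have "resolving L3 K p3 (\<lambda>x. g (f x)) X"
    unfolding resolving_def
  proof (intro ballI allI impI, elim conjE)
    fix x x' a b
    assume x: "x \<in> X" "x' \<in> X" and ab: "a \<le> b" and occ: "occurs L3 p3 a (g (f x))" "occurs L3 p3 b (g (f x))"
      and ag: "agree (a - L3) (b + L3) (g (f x)) (g (f x'))" "agree (a - K) (a + K) x x'"
    have y: "f x \<in> Y" "f x' \<in> Y" using x fX by auto
    have "agree (a - k') (a + k') (f x) (f x')"
      using sliding_agree[OF r x, of "a - k'" "a + k'"] agree_mono[OF ag(2)] pos f(2) by (simp add: K_def)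
    moreover have "occurs n' z0 a (g (f x))"
      using occurs_comp[OF occ(1) p3'(1)] pos g(1) by (simp add: L3_def)
    moreover have "occurs n' z0 (b + e) (g (f x))"
      using occurs_comp[OF occ(2) p3(4)] pos g(1) by (simp add: L3_def)
    moreover have "agree (a - n') (b + e + n') (g (f x)) (g (f x'))"
      using ag(1) by (rule agree_mono) (use pos g(1) in \<open>auto simp: L3_def\<close>)
    ultimately have yy: "agree (a - k') (b + e + k') (f x) (f x')"
      using resolvingD[OF g(4) y, of a "b + e"] ab pos by simp
    have "occurs N z1 (a + c1) (g (f x))" "occurs N z1 (b + c2) (g (f x))"
      using occurs_comp[OF occ(1) p3'(2)] occurs_comp[OF occ(2) p3'(3)] pos g(1)
      by (auto simp: L3_def L2_def L1_def)
    then obtain q1 q2 where q: "\<bar>q1\<bar> \<le> \<bar>Q\<bar>" "occurs n w (a + c1 + q1) (f x)"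
        "\<bar>q2\<bar> \<le> \<bar>Q\<bar>" "occurs n w (b + c2 + q2) (f x)"
      using visit[OF y(1)] by blast
    have "agree (a + c1 + q1 - k) (b + c2 + q2 + k) x x'"
    proof (rule resolvingD[OF f(4) x _ q(2,4)])
      show "a + c1 + q1 \<le> b + c2 + q2"
        using ab q(1,3) p2(2) f(2) g(2) r0 by (simp add: K_def)
      show "agree (a + c1 + q1 - n) (b + c2 + q2 + n) (f x) (f x')"
        using yy by (rule agree_mono) (use q(1,3) p1(2) p3(2) g(2) in auto)
      show "agree (a + c1 + q1 - k) (a + c1 + q1 + k) x x'"
        using ag(2) by (rule agree_mono) (use q(1) pos(1) f(2) g(2) r0 in \<open>auto simp: K_def\<close>)
    qed
    moreover have "a + c1 + q1 - k \<le> a + K + 1"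
      using q(1) pos(1) f(2) g(2) r0 by (simp add: K_def)
    ultimately have "agree (a - K) (b + c2 + q2 + k) x x'" by (rule agree_append[OF ag(2)])
    then show "agree (a - K) (b + K) x x'"
      by (rule agree_mono) (use q(3) p2(2) f(2) in auto)
  qed
  then show ?thesis
    using hyperbolic_if_resolving[OF tr(1,3) factor_map_compose[OF fm sub(1)] p3(1)] pos by blast
qed

section \<open>Left-transitive points and half-synchronization\<close>

lemma left_transitive_iff:
  assumes X: "subshift X"
  shows "left_transitive X x \<longleftrightarrow> x \<in> X \<and> (\<forall>x'\<in>X. \<forall>N P. \<exists>p\<ge>P. occurs N x' (- p) x)"
proof (intro iffI conjI ballI allI)
  fix x' and N P :: int assume lt: "left_transitive X x" and x': "x' \<in> X"
  define M where "M = max 0 N"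
  define u where "u = block x' (- M) M"
  have len: "int (length u) = 2 * M + 1" by (simp add: u_def length_block M_def)
  have "infinite {i. i \<le> 0 \<and> block x i (i + int (length u) - 1) = u}" (is "infinite ?S")
    using lt block_in_language[OF x'] unfolding left_transitive_def u_def by blast
  then have "\<not> ?S \<subseteq> {- P - M..0}" using finite_subset by blast
  then obtain i where "i \<in> ?S" "i \<notin> {- P - M..0}" by blast
  then have i: "i < - P - M" "block x i (i + int (length u) - 1) = u" by simp_all
  have "block (translate (i + M) x) (- M) M = block x' (- M) M"
    using i(2)[unfolded len] unfolding block_translate u_def by (simp add: algebra_simps)
  then have "occurs M x' (i + M) x" unfolding occurs_block .
  then have "occurs N x' (- (- i - M)) x" using occurs_mono[of M x' "i + M" x N] by (simp add: M_def add.commute)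
  then show "\<exists>p\<ge>P. occurs N x' (- p) x" using i(1) by (intro exI[of _ "- i - M"]) simp
next
  assume *: "x \<in> X \<and> (\<forall>x'\<in>X. \<forall>N P. \<exists>p\<ge>P. occurs N x' (- p) x)"
  show "left_transitive X x" unfolding left_transitive_def
  proof (intro conjI ballI)
    fix u assume u: "u \<in> language X"
    obtain x' where x': "x' \<in> X" "u = block x' 0 (0 + int (length u) - 1)"
      using in_language_iff[OF X, THEN iffD1, OF u, of 0] by (rule bexE)
    let ?S = "{i. i \<le> 0 \<and> block x i (i + int (length u) - 1) = u}"
    have *: "\<exists>i\<in>?S. i < c" for c
    proof -
      obtain p where p: "p \<ge> max 1 (1 - c)" "occurs (int (length u)) x' (- p) x" using * x'(1) by blast
      have "agree 0 (int (length u) - 1) (translate (- p) x) x'"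
        using p(2) unfolding occurs_shift_agree by (rule agree_mono) auto
      then have "block (translate (- p) x) 0 (int (length u) - 1) = block x' 0 (int (length u) - 1)"
        unfolding block_eq_iff .
      also have "\<dots> = u" using x'(2)[symmetric] by simp
      finally have "block x (- p) (- p + int (length u) - 1) = u"
        by (simp add: block_translate algebra_simps)
      then show ?thesis using p(1) by (intro bexI[of _ "- p"]) auto
    qed
    show "infinite ?S"
    proof
      assume fin: "finite ?S"
      obtain i where i: "i \<in> ?S" "i < Min (insert 0 ?S)" using * by blast
      have "Min (insert 0 ?S) \<le> i" using fin i(1) by (intro Min_le) auto
      then show False using i(2) by simp
    qed
  qed (use * in blast)
qed (simp add: left_transitive_def)

lemma left_transitive_image:
  assumes x: "left_transitive X x" and X: "subshift X" and r: "sliding r f X" and Y: "subshift (f ` X)"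
  shows "left_transitive (f ` X) (f x)"
  unfolding left_transitive_iff[OF Y]
proof (intro conjI ballI allI)
  have xX: "x \<in> X" using x unfolding left_transitive_def by blast
  then show "f x \<in> f ` X" by blast
  fix y N and P :: int assume "y \<in> f ` X"
  then obtain x' where x': "x' \<in> X" "y = f x'" by blast
  then obtain p where "p \<ge> P" "occurs (N + r) x' (- p) x" using x unfolding left_transitive_iff[OF X] by blast
  then show "\<exists>p\<ge>P. occurs N y (- p) (f x)" using sliding_occurs[OF r X xX x'(1)] x'(2) by blast
qed

text \<open>
Any given block of \<open>X\<close> is visited by all lifts of a suitable pattern, and this pattern occurs
arbitrarily far to the left in the image.
\<close>

lemma left_transitive_lift:
  assumes f: "hyperbolic f X Y" and x: "x \<in> X" and y: "left_transitive Y (f x)"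
  shows "left_transitive X x"
proof -
  have tr: "transitive_subshift X" "transitive_subshift Y" and fm: "factor_map f X Y"
    by (rule hyperbolicD[OF f])+
  have sub: "subshift X" "subshift Y" using tr unfolding transitive_subshift_def by blast+
  obtain r where r: "sliding r f X" and fX: "f ` X = Y" using fm unfolding factor_map_iff_sliding by (elim conjE exE)
  obtain n k w where nkw: "0 \<le> n" "0 \<le> k" "w \<in> Y" "resolving n k w f X" "lifting n k w f X"
    using hyperbolic_imp_resolving_lifting[OF f] by metis
  show ?thesis unfolding left_transitive_iff[OF sub(1)]
  proof (intro conjI ballI allI x)
    fix x' N and P :: int assume x': "x' \<in> X"
    obtain y' M Q where y': "y' \<in> Y"
      and visit: "\<And>x. x \<in> X \<Longrightarrow> occurs M y' 0 (f x) \<Longrightarrow> \<exists>q. \<bar>q\<bar> \<le> Q \<and> occurs N x' q x"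
      using every_lift_visits[OF tr(1) r nkw(4,5) _ nkw(1,2) x', of N] nkw(3) fX by metis
    obtain p where p: "p \<ge> P + \<bar>Q\<bar>" "occurs M y' (- p) (f x)"
      using y y' unfolding left_transitive_iff[OF sub(2)] by blast
    have "translate (- p) x \<in> X" "occurs M y' 0 (f (translate (- p) x))"
      using x p(2) subshift_translate[OF sub(1)] sliding_translate[OF r sub(1)] by auto
    then obtain q where "\<bar>q\<bar> \<le> Q" "occurs N x' q (translate (- p) x)" using visit by blast
    then show "\<exists>p\<ge>P. occurs N x' (- p) x" using p(1) by (intro exI[of _ "p - q"]) auto
  qed
qed

definition splice :: "(int \<Rightarrow> 'a) \<Rightarrow> (int \<Rightarrow> 'a) \<Rightarrow> (int \<Rightarrow> 'a)" where
  "splice x x' = (\<lambda>i. if i \<le> 0 then x i else x' i)"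

lemma join_rays_eq_splice: "join_rays (left_ray_at_0 x) (\<lambda>k. x' (1 + int k)) = splice x x'"
  by (auto simp: join_rays_def left_ray_at_0_def splice_def)

text \<open>
The equality of follower sets in terms of points: one inclusion always holds, and the other says that
any point agreeing with \<open>x\<close> on the last \<open>L\<close> coordinates up to the origin may replace \<open>x\<close> to the right
of the origin.
\<close>

lemma half_synchronized_iff:
  "half_synchronized X \<longleftrightarrow> transitive_subshift X \<and>
     (\<exists>x L. left_transitive X x \<and> 0 \<le> L \<and> (\<forall>x'\<in>X. agree (1 - L) 0 x x' \<longrightarrow> splice x x' \<in> X))"
proof (cases "transitive_subshift X")
  case True
  then have X: "subshift X" unfolding transitive_subshift_def by blast
  show ?thesis
  proof
    assume "half_synchronized X"
    then obtain m x where x: "left_transitive X x" "block x (- int (length m) + 1) 0 = m"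
      "follower_ray X (left_ray_at_0 x) = follower_block X m"
      unfolding half_synchronized_def by blast
    have "splice x x' \<in> X" if x': "x' \<in> X" "agree (1 - int (length m)) 0 x x'" for x'
    proof -
      let ?r = "\<lambda>k. x' (1 + int k)"
      have "translate 1 x' \<in> X" using x'(1) X by (simp add: subshift_translate)
      then have "?r \<in> right_rays X" unfolding right_rays_def translate_def
        by (intro CollectI exI[of _ "\<lambda>i. x' (i + 1)"]) (auto simp: add.commute)
      moreover have "block x' (1 - int (length m)) 0 = m"
        using x(2) x'(2) by (simp add: add.commute flip: block_eq_iff)
      ultimately have "?r \<in> follower_block X m"
        unfolding follower_block_def using x'(1)
        by (intro CollectI conjI bexI[of _ x'] exI[of _ "1 - int (length m)"]) auto
      then have "join_rays (left_ray_at_0 x) ?r \<in> X" using x(3) unfolding follower_ray_def by blast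
      then show ?thesis unfolding join_rays_eq_splice .
    qed
    then show "transitive_subshift X \<and>
     (\<exists>x L. left_transitive X x \<and> 0 \<le> L \<and> (\<forall>x'\<in>X. agree (1 - L) 0 x x' \<longrightarrow> splice x x' \<in> X))"
      using True x(1) by (intro conjI exI[of _ x] exI[of _ "int (length m)"]) auto
  next
    assume "transitive_subshift X \<and>
     (\<exists>x L. left_transitive X x \<and> 0 \<le> L \<and> (\<forall>x'\<in>X. agree (1 - L) 0 x x' \<longrightarrow> splice x x' \<in> X))"
    then obtain x L where x: "left_transitive X x" "0 \<le> L"
      "\<And>x'. x' \<in> X \<Longrightarrow> agree (1 - L) 0 x x' \<Longrightarrow> splice x x' \<in> X" by blast
    have xX: "x \<in> X" using x(1) unfolding left_transitive_def by blast
    define m where "m = block x (1 - L) 0"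
    have len: "int (length m) = L" using x(2) by (simp add: m_def length_block)
    have 1: "m \<in> language X" unfolding m_def using xX by (rule block_in_language)
    have 2: "block x (- int (length m) + 1) 0 = m" unfolding len by (simp add: m_def)
    have "follower_ray X (left_ray_at_0 x) \<subseteq> follower_block X m"
    proof
      fix s assume "s \<in> follower_ray X (left_ray_at_0 x)"
      then have s: "s \<in> right_rays X" "join_rays (left_ray_at_0 x) s \<in> X" (is "?j \<in> X")
        unfolding follower_ray_def by auto
      have "block ?j (1 - L) 0 = m" unfolding m_def block_eq_iff
        by (auto simp: agree_def join_rays_def left_ray_at_0_def)
      moreover have "?j (1 + int k) = s k" for k by (simp add: join_rays_def)
      ultimately show "s \<in> follower_block X m"
        unfolding follower_block_def len using s
        by (intro CollectI conjI bexI[of _ ?j] exI[of _ "1 - L"]) auto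
    qed
    moreover have "follower_block X m \<subseteq> follower_ray X (left_ray_at_0 x)"
    proof
      fix s assume "s \<in> follower_block X m"
      then obtain x' i where s: "s \<in> right_rays X" and x': "x' \<in> X" "block x' i (i + L - 1) = m"
        "\<And>k. x' (i + L + int k) = s k"
        unfolding follower_block_def len by blast
      let ?x = "translate (i + L - 1) x'"
      have tx: "?x \<in> X" using x'(1) X by (simp add: subshift_translate)
      have "block ?x (1 - L) 0 = m" unfolding block_translate using x'(2) by (simp add: algebra_simps)
      then have "agree (1 - L) 0 x ?x" unfolding m_def block_eq_iff by (rule agree_sym)
      then have "splice x ?x \<in> X" using x(3)[OF tx] by blast
      moreover have "s = (\<lambda>k. ?x (1 + int k))" using x'(3) by (auto simp: translate_def algebra_simps)
      ultimately show "s \<in> follower_ray X (left_ray_at_0 x)"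
        unfolding follower_ray_def using s join_rays_eq_splice[of x ?x] by simp
    qed
    ultimately have "follower_ray X (left_ray_at_0 x) = follower_block X m" by blast
    then show "half_synchronized X" unfolding half_synchronized_def using True 1 2 x(1) by blast
  qed
qed (simp add: half_synchronized_def)

text \<open>
Let \<open>y\<close> be the half-synchronizing point downstairs and \<open>u\<close> a preimage of it. If \<open>u'\<close> agrees with \<open>u\<close> on a
long block, its image may be spliced to \<open>y\<close>. Lift the spliced point so that the lift agrees with \<open>u'\<close> at
an occurrence of the resolving word in that block. To the left, backward determinism makes the lift
agree with \<open>u\<close>, as the word occurs arbitrarily far to the left in \<open>y\<close>. To the right, the lift must agree with
\<open>u'\<close> up to the last occurrence of the word; since \<open>u'\<close> may contain no further occurrence, it is first
replaced by points that agree with it on long windows and then show the word, and the conclusion for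
\<open>u'\<close> follows because \<open>U\<close> is closed. The splitting point upstairs is \<open>r\<close> instead of the origin, since the image
up to the origin depends on the coordinates up to \<open>r\<close>.
\<close>

theorem half_synchronized_lift:
  assumes f: "hyperbolic f U Y" and Y: "half_synchronized Y"
  shows "half_synchronized U"
proof -
  have tr: "transitive_subshift U" "transitive_subshift Y" and fm: "factor_map f U Y"
    by (rule hyperbolicD[OF f])+
  have sub: "subshift U" "subshift Y" using tr unfolding transitive_subshift_def by blast+
  obtain r where r: "sliding r f U" and fU: "f ` U = Y" using fm unfolding factor_map_iff_sliding by (elim conjE exE)
  have r0: "0 \<le> r" using r by (simp add: sliding_def)
  obtain n k w where nk: "0 \<le> n" "0 \<le> k" and w: "w \<in> Y" and res: "resolving n k w f U" and lift: "lifting n k w f U"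
    using hyperbolic_imp_resolving_lifting[OF f] by metis
  obtain y L where y: "left_transitive Y y" "0 \<le> L" and sync: "\<And>y'. y' \<in> Y \<Longrightarrow> agree (1 - L) 0 y y' \<Longrightarrow> splice y y' \<in> Y"
    using Y unfolding half_synchronized_iff by blast
  have often: "\<exists>p\<ge>P. occurs N y' (- p) y" if "y' \<in> Y" for y' N P
    using y(1) that unfolding left_transitive_iff[OF sub(2)] by blast
  have "y \<in> Y" using y(1) unfolding left_transitive_def by blast
  then obtain u where u: "u \<in> U" "f u = y" using fU by blast
  have ltu: "left_transitive U u" using left_transitive_lift[OF f u(1)] u(2) y(1) by simp
  obtain c where c: "c \<ge> n + k" "occurs n w (- c) y" using often[OF w] by blast
  define M where "M = L + c + n + k + r"
  obtain v0 where v0: "v0 \<in> U" "f v0 = w" using w fU by blast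
  have key: "(\<lambda>i. if i \<le> r then u i else u' i) \<in> U" if u': "u' \<in> U" "agree (- M) r u u'" for u'
  proof (rule subshift_closed[OF sub(1)])
    fix N :: int
    define R where "R = \<bar>N\<bar> + M + r"
    have Mpos: "0 \<le> M" using y(2) c(1) nk r0 by (simp add: M_def)
    obtain v t where v: "v \<in> U" "R \<le> t" "occurs R u' 0 v" "occurs (n + r) v0 t v"
      using transitive_two_patterns[OF tr(1) u'(1) v0(1)] by blast
    have vu': "agree (- R) R v u'" using v(3) unfolding occurs_eq_agree .
    have vu: "agree (- M) r v u"
      using agree_trans[OF agree_mono[OF vu'] agree_sym[OF u'(2)]] r0 Mpos by (simp add: R_def)
    have fvy: "agree (- M + r) 0 (f v) y"
      using sliding_agree[OF r v(1) u(1), of "- M + r" 0] vu u(2) by simp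
    define y' where "y' = splice y (f v)"
    have "agree (1 - L) 0 y (f v)"
      by (rule agree_sym[OF agree_mono[OF fvy]]) (use c nk in \<open>auto simp: M_def\<close>)
    then have y': "y' \<in> Y" unfolding y'_def using sync v(1) fU by blast
    \<comment> \<open>The two descriptions of \<open>y'\<close> overlap on the window where the image of \<open>v\<close> agrees with \<open>y\<close>.\<close>
    have left: "y' i = y i" if "i \<le> 0" for i using that by (simp add: y'_def splice_def)
    have right: "y' i = f v i" if "- M + r \<le> i" for i
      using that agreeD[OF fvy, of i] by (auto simp: y'_def splice_def)
    have occ1: "occurs n w (- c) (f v)"
      by (rule occurs_agree[OF c(2) agree_sym[OF fvy]]) (use c(1) y(2) nk in \<open>auto simp: M_def\<close>)
    have occ2: "occurs n w (- c) y'"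
      by (rule occurs_agree[OF c(2), of "- c - n" "- c + n"]) (use left c(1) nk in \<open>auto simp: agree_def\<close>)
    have occt: "occurs n w t (f v)" using sliding_occurs[OF r sub(1) v(1) v0(1) v(4)] v0(2) by simp
    obtain x where x: "x \<in> U" "f x = y'" "agree (- c - k) (- c + k) x v"
      using liftingD[OF lift v(1) _ occ1 occ2] y' fU by blast
    have "agree (- c - k) (t + k) v x"
    proof (rule resolvingD[OF res v(1) x(1) _ occ1 occt])
      show "- c \<le> t" using v(2) c(1) nk Mpos r0 by (simp add: R_def)
      show "agree (- c - n) (t + n) (f v) (f x)" unfolding x(2) agree_def
        using right y(2) nk by (auto simp: M_def)
      show "agree (- c - k) (- c + k) v x" using x(3) by (rule agree_sym)
    qed
    then have xv: "agree (- c - k) (t + k) x v" by (rule agree_sym)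
    have xu0: "agree (- c - k) (- c + k) x u"
      using agree_trans[OF x(3) agree_mono[OF vu]] y(2) c(1) nk r0 by (simp add: M_def)
    have xu: "x i = u i" if i: "i \<le> - c + k" for i
    proof -
      obtain p where p: "p \<ge> c + \<bar>i\<bar> + k" "occurs n w (- p) y" using often[OF w] by blast
      have yy: "agree (- p - n) (- c + n) y' y" using left c(1) nk by (auto simp: agree_def)
      have occp: "occurs n w (- p) y'"
        by (rule occurs_agree[OF p(2) agree_sym[OF yy]]) (use p(1) nk in auto)
      have "agree (- p - k) (- c + k) x u"
        using resolving_backwards[OF sub(1) r res lift x(1) u(1), of "- p" "- c"]
          p(1) occp occ2 yy xu0 nk x(2) u(2) by simp
      then show ?thesis by (rule agreeD) (use i p(1) nk c(1) in auto)
    qed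
    have "x i = (if i \<le> r then u i else u' i)" if i: "- N \<le> i" "i \<le> N" for i
    proof (cases "i \<le> - c + k")
      case True
      then show ?thesis using xu c(1) nk r0 by simp
    next
      case False
      then have 1: "x i = v i" using agreeD[OF xv, of i] i v(2) Mpos r0 nk by (simp add: R_def)
      show ?thesis
      proof (cases "i \<le> r")
        case True
        then have "v i = u i" using agreeD[OF vu, of i] False y(2) nk r0 by (simp add: M_def)
        then show ?thesis using 1 True by simp
      next
        case False
        then have "v i = u' i" using agreeD[OF vu', of i] i Mpos r0 by (simp add: R_def)
        then show ?thesis using 1 False by simp
      qed
    qed
    then have "agree (- N) N x (\<lambda>i. if i \<le> r then u i else u' i)" by (simp add: agree_def)
    then show "\<exists>x'\<in>U. agree (- N) N x' (\<lambda>i. if i \<le> r then u i else u' i)" using x(1) by blast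
  qed
  define x where "x = translate r u"
  have "left_transitive U x" unfolding left_transitive_iff[OF sub(1)]
  proof (intro conjI ballI allI)
    show "x \<in> U" unfolding x_def using u(1) sub(1) by (simp add: subshift_translate)
    fix x' N and P :: int assume "x' \<in> U"
    then obtain p where "p \<ge> P" "occurs N x' (- p) u" using ltu unfolding left_transitive_iff[OF sub(1)] by blast
    then show "\<exists>p\<ge>P. occurs N x' (- p) x" using r0 by (intro exI[of _ "p + r"]) (simp add: x_def)
  qed
  moreover have "splice x x' \<in> U" if x': "x' \<in> U" "agree (1 - (M + r + 1)) 0 x x'" for x'
  proof -
    define u' where "u' = translate (- r) x'"
    have x'u: "x' = translate r u'" by (simp add: u'_def)
    have "u' \<in> U" using x'(1) sub(1) by (simp add: u'_def subshift_translate)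
    moreover have "agree (- M) r u u'" using x'(2) unfolding x'u x_def by simp
    ultimately have "translate r (\<lambda>i. if i \<le> r then u i else u' i) \<in> U"
      using key subshift_translate[OF sub(1)] by blast
    moreover have "translate r (\<lambda>i. if i \<le> r then u i else u' i) = splice x x'"
      unfolding x'u x_def splice_def by (auto simp: translate_def)
    ultimately show ?thesis by simp
  qed
  moreover have "0 \<le> M + r + 1" using y(2) c(1) nk r0 by (simp add: M_def)
  ultimately show ?thesis unfolding half_synchronized_iff using tr(1) by blast
qed

section \<open>Orbit closures of recurrent points\<close>

definition orbit_closure :: "(int \<Rightarrow> 'a) \<Rightarrow> (int \<Rightarrow> 'a) set" where
  "orbit_closure u = {x. \<forall>N. \<exists>t. occurs N x t u}"

lemma orbit_closure_subshift:
  assumes "finite (range u)"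
  shows "subshift (orbit_closure u)"
proof (rule subshift_overI[OF assms])
  show "orbit_closure u \<subseteq> {x. range x \<subseteq> range u}"
  proof clarify
    fix x i assume "x \<in> orbit_closure u"
    then obtain t where "occurs \<bar>i\<bar> x t u" unfolding orbit_closure_def by blast
    then have "u (t + i) = x i" using occursD[of "\<bar>i\<bar>" x t u "t + i"] by simp
    then show "x i \<in> range u" by (metis rangeI)
  qed
  show "translate q x \<in> orbit_closure u" if x: "x \<in> orbit_closure u" for x q
    unfolding orbit_closure_def
  proof (intro CollectI allI)
    fix N
    obtain t where "occurs (\<bar>q\<bar> + N) x t u" using x unfolding orbit_closure_def by blast
    moreover have "occurs N (translate q x) q x" by (simp add: occurs_def translate_def add.commute)
    ultimately have "occurs N (translate q x) (t + q) u" using occurs_comp by force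
    then show "\<exists>t. occurs N (translate q x) t u" by blast
  qed
  show "x \<in> orbit_closure u" if appr: "\<And>N. \<exists>x'\<in>orbit_closure u. agree (- N) N x' x" for x
    unfolding orbit_closure_def
  proof (intro CollectI allI)
    fix N
    obtain x' where x': "x' \<in> orbit_closure u" "agree (- N) N x' x" using appr by blast
    obtain t where "occurs N x' t u" using x'(1) unfolding orbit_closure_def by blast
    then have "occurs N x t u" using x'(2) agree_trans unfolding occurs_shift_agree by blast
    then show "\<exists>t. occurs N x t u" by blast
  qed
qed simp

text \<open>
Two patterns occurring in \<open>u\<close> can be met in the desired order: by recurrence, the first one also occurs
far to the left of the second.
\<close>

lemma orbit_closure_transitive:
  assumes fin: "finite (range u)" and rec: "\<And>N P. \<exists>p\<ge>P. occurs N u (- p) u"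
  shows "transitive_subshift (orbit_closure u)"
  unfolding transitive_subshift_iff
proof (intro conjI ballI allI orbit_closure_subshift fin)
  fix x y and N R :: int assume x: "x \<in> orbit_closure u" and y: "y \<in> orbit_closure u"
  obtain t1 where t1: "occurs N x t1 u" using x unfolding orbit_closure_def by blast
  obtain t2 where t2: "occurs N y t2 u" using y unfolding orbit_closure_def by blast
  obtain p where p: "p \<ge> R + t1 - t2" "occurs (\<bar>t1\<bar> + N) u (- p) u" using rec by blast
  have xp: "occurs N x (- p + t1) u" using occurs_comp[OF p(2) t1] by simp
  define z where "z = translate (- p + t1) u"
  have "u \<in> orbit_closure u" unfolding orbit_closure_def using occurs_self by blast
  then have "z \<in> orbit_closure u" unfolding z_def using orbit_closure_subshift[OF fin] by (simp add: subshift_translate)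
  moreover have "occurs N x 0 z" "occurs N y (t2 - t1 + p) z" using xp t2 by (simp_all add: z_def)
  ultimately show "\<exists>z\<in>orbit_closure u. \<exists>q\<ge>R. occurs N x 0 z \<and> occurs N y q z"
    using p(1) by (intro bexI[of _ z] exI[of _ "t2 - t1 + p"]) auto
qed

section \<open>Fibre products\<close>

text \<open>
Call \<open>R w w'\<close> the relation that far to the left the pair \<open>(v, w)\<close> shows arbitrarily long central windows
of \<open>(v, w')\<close>. Every lift \<open>w\<close> is related to some lift, by compactness and because \<open>v\<close> recurs to its
left; and \<open>R\<close> is transitive. In an infinite chain of lifts two have the same central block at an occurrence
of the resolving word, hence the same left ray by backward determinism. The relation depends on the left
ray of its first argument only, so the later of the two is related to itself.
\<close>

lemma recurrent_lift:
  fixes W :: "(int \<Rightarrow> 'b) set"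
  assumes v: "left_transitive V v" and V: "subshift V" and g: "sliding s g V" and gV: "g ` V = Y"
    and h: "hyperbolic h W Y"
  obtains w where "w \<in> W" "h w = g v" "\<And>N P. \<exists>p\<ge>P. occurs N v (- p) v \<and> occurs N w (- p) w"
proof -
  have sub: "subshift W" "subshift Y" using hyperbolicD[OF h] unfolding transitive_subshift_def by blast+
  obtain r where r: "sliding r h W" and hW: "h ` W = Y"
    using hyperbolicD(3)[OF h] unfolding factor_map_iff_sliding by (elim conjE exE)
  obtain n k w0 where nk: "0 \<le> n" "0 \<le> k" and w0: "w0 \<in> Y" and res: "resolving n k w0 h W" and lift: "lifting n k w0 h W"
    using hyperbolic_imp_resolving_lifting[OF h] by metis
  define y where "y = g v"
  have vV: "v \<in> V" using v unfolding left_transitive_def by blast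
  have "left_transitive Y y"
    using left_transitive_image[OF v V g] gV sub(2) by (simp add: y_def)
  then have yY: "y \<in> Y" and often: "\<And>N P. \<exists>p\<ge>P. occurs N w0 (- p) y"
    using w0 unfolding left_transitive_iff[OF sub(2)] by blast+
  have v_often: "\<exists>p\<ge>P. occurs N v (- p) v" for N P
    using v vV unfolding left_transitive_iff[OF V] by blast
  define R where "R w w' \<longleftrightarrow> (\<forall>N P. \<exists>p\<ge>P. occurs N v (- p) v \<and> occurs N w' (- p) w)" for w w' :: "int \<Rightarrow> 'b"
  define F where "F = {w \<in> W. h w = y}"
  have step: "\<exists>w'\<in>F. R w w'" if "w \<in> F" for w
  proof -
    have w: "w \<in> W" "h w = y" using that by (auto simp: F_def)
    have "\<forall>j. \<exists>p. p \<ge> int j \<and> occurs (int j) v (- p) v" using v_often by blast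
    then obtain p where p: "\<And>j. p j \<ge> int j" "\<And>j. occurs (int j) v (- p j) v" by metis
    define t where "t j = translate (- p j) w" for j
    have tW: "t j \<in> W" for j unfolding t_def using w(1) sub(1) by (simp add: subshift_translate)
    obtain w' where w': "w' \<in> W" "\<And>N M. \<exists>j\<ge>M. agree (- N) N (t j) w'"
      by (rule subshift_accumulation_point[OF sub(1) tW]) (rule that)
    have "h w' i = y i" for i
    proof -
      obtain j where j: "j \<ge> nat (\<bar>i\<bar> + s)" "agree (- (\<bar>i\<bar> + r)) (\<bar>i\<bar> + r) (t j) w'" using w'(2) by blast
      have "agree (- \<bar>i\<bar>) \<bar>i\<bar> (h (t j)) (h w')"
        by (rule sliding_agree[OF r tW w'(1)]) (rule agree_mono[OF j(2)], simp_all)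
      then have 1: "h (t j) i = h w' i" by (rule agreeD) auto
      have "h (t j) = translate (- p j) (g v)"
        unfolding t_def using sliding_translate[OF r sub(1) w(1)] w(2) y_def by simp
      moreover have "occurs \<bar>i\<bar> y (- p j) (g v)"
        unfolding y_def
        by (rule sliding_occurs[OF g V vV vV]) (rule occurs_mono[OF p(2)[of j]], use j(1) in simp)
      ultimately have "h (t j) i = y i"
        using occursD[of "\<bar>i\<bar>" y "- p j" "g v" "- p j + i"] by (simp add: translate_def)
      then show ?thesis using 1 by simp
    qed
    then have "w' \<in> F" using w'(1) by (auto simp: F_def)
    moreover have "R w w'" unfolding R_def
    proof (intro allI)
      fix N P
      obtain j where j: "j \<ge> nat (max N P)" "agree (- N) N (t j) w'" using w'(2) by blast
      have "occurs N v (- p j) v" by (rule occurs_mono[OF p(2)]) (use j(1) in simp)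
      moreover have "occurs N w' (- p j) w" using j(2) unfolding t_def occurs_shift_agree .
      moreover have "p j \<ge> P" using p(1)[of j] j(1) by simp
      ultimately show "\<exists>p\<ge>P. occurs N v (- p) v \<and> occurs N w' (- p) w" by blast
    qed
    ultimately show ?thesis by blast
  qed
  have R_trans: "R w w''" if R1: "R w w'" and R2: "R w' w''" for w w' w''
    unfolding R_def
  proof (intro allI)
    fix N P
    obtain p where p: "p \<ge> 0" "occurs N v (- p) v" "occurs N w'' (- p) w'" using R2 unfolding R_def by blast
    obtain q where q: "q \<ge> P" "occurs (N + p) v (- q) v" "occurs (N + p) w' (- q) w" using R1 unfolding R_def by blast
    have "occurs N v (- q + - p) v" "occurs N w'' (- q + - p) w"
      using occurs_comp[OF q(2) p(2)] occurs_comp[OF q(3) p(3)] p(1) by auto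
    then show "\<exists>p\<ge>P. occurs N v (- p) v \<and> occurs N w'' (- p) w"
      using q(1) p(1) by (intro exI[of _ "q + p"]) auto
  qed
  obtain w1 where "w1 \<in> F" using yY hW unfolding F_def by blast
  then obtain ws where ws: "\<And>j. ws j \<in> F" "\<And>j. R (ws j) (ws (Suc j))"
    using dependent_nat_choice[of "\<lambda>_ w. w \<in> F" "\<lambda>_. R"] step by metis
  have R_less: "R (ws a) (ws b)" if "a < b" for a b
    using that by (induction rule: less_Suc_induct) (use ws(2) R_trans in blast)+
  obtain c where c: "occurs n w0 (- c) y" using often by blast
  define B where "B w = block w (- c - k) (- c + k)" for w :: "int \<Rightarrow> 'b"
  have "finite (range (\<lambda>j. B (ws j)))"
    using finite_subshift_blocks[OF sub(1), of "- c - k" "- c + k"]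
    by (rule finite_subset[rotated]) (use ws(1) in \<open>auto simp: B_def F_def\<close>)
  then have "\<not> inj (\<lambda>j. B (ws j))" using finite_imageD infinite_UNIV_nat by blast
  then obtain a b where ab: "a < b" "B (ws a) = B (ws b)"
    unfolding inj_def by (metis linorder_neqE_nat)
  define w where "w = ws b"
  have wF: "w \<in> W" "h w = y" and waF: "ws a \<in> W" "h (ws a) = y" using ws(1) by (auto simp: w_def F_def)
  have wa_w: "ws a i = w i" if i: "i \<le> - c + k" for i
  proof -
    obtain p where p: "p \<ge> \<bar>c\<bar> + \<bar>i\<bar>" "occurs n w0 (- p) y" using often by blast
    have "agree (- c - k) (- c + k) (ws a) w" using ab(2) unfolding B_def block_eq_iff w_def .
    then have "agree (- p - k) (- c + k) (ws a) w"
      using resolving_backwards[OF sub(1) r res lift waF(1) wF(1), of "- p" "- c"] p c nk waF(2) wF(2)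
      by (simp add: agree_def)
    then show ?thesis by (rule agreeD) (use p(1) i nk in auto)
  qed
  have "\<exists>p\<ge>P. occurs N v (- p) v \<and> occurs N w (- p) w" for N P
  proof -
    obtain p where p: "p \<ge> max P (N + \<bar>c\<bar>)" "occurs N v (- p) v" "occurs N w (- p) (ws a)"
      using R_less[OF ab(1)] unfolding R_def w_def by blast
    have "occurs N w (- p) w"
      by (rule occurs_agree[OF p(3), of "- p - N" "- p + N"]) (use p(1) nk wa_w in \<open>auto simp: agree_def\<close>)
    then show ?thesis using p by (intro exI[of _ p]) simp
  qed
  then show thesis using that wF unfolding y_def by blast
qed

text \<open>
A point of \<open>V\<close> is a limit of translates of \<open>v\<close>; along a subsequence the same translates of \<open>w\<close> converge as
well, and the pair of limits lies in the orbit closure.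
\<close>

lemma coded_closure_projects_onto:
  assumes V: "subshift V" and W: "subshift W" and v: "v \<in> V" and w: "w \<in> W"
    and dense: "\<And>v' N. v' \<in> V \<Longrightarrow> \<exists>t. occurs N v' t v"
    and c: "\<And>a b. p1 (c a b) = a" 
  shows "(\<lambda>x i. p1 (x i)) ` orbit_closure (\<lambda>i. c (v i) (w i)) = V"
proof
  let ?u = "\<lambda>i. c (v i) (w i)"
  show "(\<lambda>x i. p1 (x i)) ` orbit_closure ?u \<subseteq> V"
  proof clarify
    fix x assume x: "x \<in> orbit_closure ?u"
    show "(\<lambda>i. p1 (x i)) \<in> V"
    proof (rule subshift_closed[OF V])
      fix N
      obtain t where "occurs N x t ?u" using x unfolding orbit_closure_def by blast
      then have "occurs N (\<lambda>i. p1 (x i)) t v" unfolding occurs_def by (metis c)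
      then show "\<exists>x'\<in>V. agree (- N) N x' (\<lambda>i. p1 (x i))"
        unfolding occurs_shift_agree using subshift_translate[OF V v] by blast
    qed
  qed
  show "V \<subseteq> (\<lambda>x i. p1 (x i)) ` orbit_closure ?u"
  proof
    fix v' assume v': "v' \<in> V"
    have "\<forall>j. \<exists>t. occurs (int j) v' t v" using dense[OF v'] by blast
    then obtain t where t: "\<And>j. occurs (int j) v' (t j) v" by metis
    obtain w' where w': "w' \<in> W" "\<And>N M. \<exists>j\<ge>M. agree (- N) N (translate (t j) w) w'"
      by (rule subshift_accumulation_point[OF W subshift_translate[OF W w], of t]) (rule that)
    let ?x = "\<lambda>i. c (v' i) (w' i)"
    have "?x \<in> orbit_closure ?u" unfolding orbit_closure_def
    proof (intro CollectI allI)
      fix N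
      obtain j where j: "j \<ge> nat N" "agree (- N) N (translate (t j) w) w'" using w'(2) by blast
      have "occurs N v' (t j) v" by (rule occurs_mono[OF t]) (use j(1) in simp)
      moreover have "occurs N w' (t j) w" using j(2) unfolding occurs_shift_agree .
      ultimately have "occurs N ?x (t j) ?u" by (simp add: occurs_def)
      then show "\<exists>t. occurs N ?x t ?u" by blast
    qed
    then show "v' \<in> (\<lambda>x i. p1 (x i)) ` orbit_closure ?u" by (rule rev_image_eqI) (simp add: c)
  qed
qed

text \<open>
The word of \<open>Y\<close> that resolves \<open>h\<close> is lifted to a pattern \<open>v0\<close> of \<open>V\<close>. Agreement of the first coordinates
forces agreement of their images in \<open>Y\<close>, and then \<open>h\<close> determines the second coordinates to the right.
\<close>

lemma projection_hyperbolic: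
  assumes U: "transitive_subshift U" and V: "transitive_subshift V" and onto: "(\<lambda>x i. p1 (x i)) ` U = V"
    and g: "sliding s g V" and gV: "g ` V = Y" and h: "hyperbolic h W Y"
    and UW: "\<And>x. x \<in> U \<Longrightarrow> (\<lambda>i. p2 (x i)) \<in> W \<and> h (\<lambda>i. p2 (x i)) = g (\<lambda>i. p1 (x i))"
    and inj: "\<And>a b. p1 a = p1 b \<Longrightarrow> p2 a = p2 b \<Longrightarrow> a = b"
  shows "hyperbolic (\<lambda>x i. p1 (x i)) U V"
proof -
  have sub: "subshift U" "subshift V" using U V unfolding transitive_subshift_def by blast+
  obtain n k w0 where nk: "0 \<le> n" "0 \<le> k" and w0: "w0 \<in> Y" and res: "resolving n k w0 h W"
    using hyperbolic_imp_resolving_lifting[OF h] by metis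
  obtain v0 where v0: "v0 \<in> V" "g v0 = w0" using w0 gV by blast
  have s0: "0 \<le> s" using g by (simp add: sliding_def)
  let ?p1 = "\<lambda>x i. p1 (x i)" and ?p2 = "\<lambda>x i. p2 (x i)"
  define M where "M = n + s + k"
  have "sliding 0 ?p1 U" by (auto simp: sliding_def agree_def translate_def)
  then have fm: "factor_map ?p1 U V" unfolding factor_map_iff_sliding using onto by blast
  have "resolving M k v0 ?p1 U" unfolding resolving_def
  proof (intro ballI allI impI, elim conjE)
    fix x x' a b
    assume x: "x \<in> U" "x' \<in> U" and ab: "a \<le> b" and occ: "occurs M v0 a (?p1 x)" "occurs M v0 b (?p1 x)"
      and ag: "agree (a - M) (b + M) (?p1 x) (?p1 x')" "agree (a - k) (a + k) x x'"
    have pV: "?p1 x \<in> V" "?p1 x' \<in> V" using x onto by auto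
    have occ': "occurs n w0 a (g (?p1 x))" "occurs n w0 b (g (?p1 x))"
      using sliding_occurs[OF g sub(2) pV(1) v0(1)] occurs_mono[OF occ(1)] occurs_mono[OF occ(2)] v0(2) nk
      by (auto simp: M_def)
    have "agree (a - n) (b + n) (g (?p1 x)) (g (?p1 x'))"
      by (rule sliding_agree[OF g pV]) (rule agree_mono[OF ag(1)], use nk in \<open>auto simp: M_def\<close>)
    moreover have "agree (a - k) (a + k) (?p2 x) (?p2 x')" using ag(2) by (simp add: agree_def)
    ultimately have "agree (a - k) (b + k) (?p2 x) (?p2 x')"
      using resolvingD[OF res _ _ ab, of "?p2 x" "?p2 x'"] occ' UW[OF x(1)] UW[OF x(2)] by simp
    moreover have "agree (a - k) (b + k) (?p1 x) (?p1 x')"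
      by (rule agree_mono[OF ag(1)]) (use nk s0 in \<open>auto simp: M_def\<close>)
    ultimately show "agree (a - k) (b + k) x x'" unfolding agree_def using inj by blast
  qed
  then show ?thesis
    using hyperbolic_if_resolving[OF U V fm v0(1)] nk s0 by (simp add: M_def)
qed

text \<open>
An infinite set is equipotent to its square.
\<close>

lemma infinite_pairing:
  obtains c :: "'a::infinite \<Rightarrow> 'a \<Rightarrow> 'a" and p1 p2 where
    "\<And>a b. p1 (c a b) = a" "\<And>a b. p2 (c a b) = b" "\<And>x. c (p1 x) (p2 x) = x"
proof -
  have "(card_of ((UNIV :: 'a set) \<times> (UNIV :: 'a set)), card_of (UNIV :: 'a set)) \<in> ordIso"
    by (rule card_of_Times_same_infinite) (rule infinite_UNIV)
  then obtain f :: "'a \<times> 'a \<Rightarrow> 'a" where "bij_betw f (UNIV \<times> UNIV) UNIV"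
    unfolding card_of_ordIso[symmetric] by blast
  then have f: "bij f" by simp
  show thesis
  proof (rule that[of "fst \<circ> inv f" "\<lambda>a b. f (a, b)" "snd \<circ> inv f"])
    show "(fst \<circ> inv f) (f (a, b)) = a" "(snd \<circ> inv f) (f (a, b)) = b" for a b
      using f by (simp_all add: bij_is_inj)
    show "f ((fst \<circ> inv f) x, (snd \<circ> inv f) x) = x" for x
      using f by (simp add: bij_is_surj surj_f_inv_f)
  qed
qed

text \<open>
The subshift \<open>U\<close> is the orbit closure of a pair of left-transitive points with the same image in \<open>Y\<close> that is
recurrent to the left. It is half-synchronized because its projection to \<open>V\<close> is hyperbolic.
\<close>

theorem common_hyperbolic_extension:
  fixes V W Y :: "(int \<Rightarrow> 'a::infinite) set"
  assumes g: "hyperbolic g V Y" and h: "hyperbolic h W Y" and Y: "half_synchronized Y"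
  shows "\<exists>(U :: (int \<Rightarrow> 'a) set) f f'. half_synchronized U \<and> hyperbolic f U V \<and> hyperbolic f' U W"
proof -
  have trV: "transitive_subshift V" and trW: "transitive_subshift W"
    using hyperbolicD[OF g] hyperbolicD[OF h] by blast+
  then have V: "subshift V" and W: "subshift W" unfolding transitive_subshift_def by blast+
  obtain s where s: "sliding s g V" and gV: "g ` V = Y"
    using hyperbolicD(3)[OF g] unfolding factor_map_iff_sliding by (elim conjE exE)
  obtain r where r: "sliding r h W" and hW: "h ` W = Y"
    using hyperbolicD(3)[OF h] unfolding factor_map_iff_sliding by (elim conjE exE)
  have hsV: "half_synchronized V" using half_synchronized_lift[OF g Y] .
  then obtain v where v: "left_transitive V v" unfolding half_synchronized_def by blast
  then have vV: "v \<in> V" unfolding left_transitive_def by blast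
  obtain w where w: "w \<in> W" "h w = g v" and rec: "\<And>N P. \<exists>p\<ge>P. occurs N v (- p) v \<and> occurs N w (- p) w"
    using recurrent_lift[OF v V s gV h] by blast
  have "subshift Y" using hyperbolicD(2)[OF g] unfolding transitive_subshift_def by blast
  then have "left_transitive Y (h w)" using left_transitive_image[OF v V s] gV w(2) by simp
  then have ltw: "left_transitive W w" using left_transitive_lift[OF h w(1)] by blast
  obtain c :: "'a \<Rightarrow> 'a \<Rightarrow> 'a" and p1 p2 where
    c: "\<And>a b. p1 (c a b) = a" "\<And>a b. p2 (c a b) = b" "\<And>x. c (p1 x) (p2 x) = x"
    by (rule infinite_pairing) (rule that)
  define u where "u = (\<lambda>i. c (v i) (w i))"
  define U where "U = orbit_closure u"
  obtain A where A: "finite A" "V \<subseteq> {x. range x \<subseteq> A}" using V by (rule subshift_alphabet)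
  obtain B where B: "finite B" "W \<subseteq> {x. range x \<subseteq> B}" using W by (rule subshift_alphabet)
  have "range u \<subseteq> (\<lambda>(a, b). c a b) ` (A \<times> B)" using A(2) B(2) vV w(1) unfolding u_def by fast
  then have fin: "finite (range u)" using A(1) B(1) by (meson finite_SigmaI finite_imageI finite_subset)
  have U: "transitive_subshift U" unfolding U_def
  proof (rule orbit_closure_transitive[OF fin])
    fix N P
    obtain p where "p \<ge> P" "occurs N v (- p) v" "occurs N w (- p) w" using rec by blast
    then show "\<exists>p\<ge>P. occurs N u (- p) u" by (intro exI[of _ p]) (simp add: u_def occurs_def)
  qed
  have dense1: "\<exists>t. occurs N v' t v" if "v' \<in> V" for v' N
    using v that unfolding left_transitive_iff[OF V] by blast
  have onto1: "(\<lambda>x i. p1 (x i)) ` U = V"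
    unfolding U_def u_def
    using coded_closure_projects_onto[of V W v w p1 c, OF V W vV w(1) dense1 c(1)] .
  have dense2: "\<exists>t. occurs N w' t w" if "w' \<in> W" for w' N
    using ltw that unfolding left_transitive_iff[OF W] by blast
  have onto2: "(\<lambda>x i. p2 (x i)) ` U = W"
    unfolding U_def u_def
    using coded_closure_projects_onto[of W V w v p2 "\<lambda>b a. c a b", OF W V w(1) vV dense2 c(2)] .
  have fibre: "h (\<lambda>i. p2 (x i)) = g (\<lambda>i. p1 (x i))" if x: "x \<in> U" for x
  proof
    fix i
    obtain t where t: "occurs (\<bar>i\<bar> + r + s) x t u" using x unfolding U_def orbit_closure_def by blast
    have rs: "0 \<le> r" "0 \<le> s" using r s by (auto simp: sliding_def)
    have "occurs (\<bar>i\<bar> + r + s) (\<lambda>i. p1 (x i)) t v" "occurs (\<bar>i\<bar> + r + s) (\<lambda>i. p2 (x i)) t w"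
      using t unfolding u_def occurs_def by (metis c(1), metis c(2))
    then have 1: "occurs \<bar>i\<bar> (g (\<lambda>i. p1 (x i))) t (g v)" and 2: "occurs \<bar>i\<bar> (h (\<lambda>i. p2 (x i))) t (h w)"
      using rs x onto1 onto2
      by (auto intro!: sliding_occurs[OF s V vV] sliding_occurs[OF r W w(1)] elim!: occurs_mono)
    then show "h (\<lambda>i. p2 (x i)) i = g (\<lambda>i. p1 (x i)) i"
      using occursD[OF 1, of "t + i"] occursD[OF 2, of "t + i"] w(2) by simp
  qed
  have inj: "a = b" if "p1 a = p1 b" "p2 a = p2 b" for a b using that c(3) by metis
  have 1: "hyperbolic (\<lambda>x i. p1 (x i)) U V"
    by (rule projection_hyperbolic[OF U trV onto1 s gV h, of p2]) (use onto2 fibre inj in blast)+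
  have 2: "hyperbolic (\<lambda>x i. p2 (x i)) U W"
    by (rule projection_hyperbolic[OF U trW onto2 r hW g, of p1]) (use onto1 fibre inj in force)+
  show ?thesis using half_synchronized_lift[OF 1 hsV] 1 2 by blast
qed

section \<open>The equivalence relation\<close>

lemma hyperbolic_identity:
  assumes "half_synchronized X"
  shows "hyperbolic (\<lambda>x. x) X X"
proof -
  have X: "transitive_subshift X" using assms unfolding half_synchronized_def by blast
  obtain x where x: "x \<in> X" using assms unfolding half_synchronized_def left_transitive_def by blast
  have "sliding 0 (\<lambda>x. x) X" by (auto simp: sliding_def agree_def translate_def)
  then have "factor_map (\<lambda>x. x) X X" unfolding factor_map_iff_sliding by auto
  moreover have "resolving 0 0 x (\<lambda>x. x) X" by (auto simp: resolving_def)
  ultimately show ?thesis using hyperbolic_if_resolving[OF X X _ x] by blast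
qed

theorem theorem3p4:
  shows "equiv {X :: (int \<Rightarrow> 'a::infinite) set. half_synchronized X}
    {(X, Y). half_synchronized X \<and> half_synchronized Y \<and> common_hs_hyperbolic_extension X Y}"
proof (rule equivI)
  let ?S = "{X :: (int \<Rightarrow> 'a::infinite) set. half_synchronized X}"
  let ?r = "{(X :: (int \<Rightarrow> 'a) set, Y). half_synchronized X \<and> half_synchronized Y \<and> common_hs_hyperbolic_extension X Y}"
  show "?r \<subseteq> ?S \<times> ?S" by auto
  show "refl_on ?S ?r"
    by (rule refl_onI) (use hyperbolic_identity in \<open>auto simp: common_hs_hyperbolic_extension_def\<close>)
  show "sym ?r" by (rule symI) (auto simp: common_hs_hyperbolic_extension_def)
  show "trans ?r"
  proof (rule transI)
    fix X Y Z :: "(int \<Rightarrow> 'a) set"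
    assume "(X, Y) \<in> ?r" "(Y, Z) \<in> ?r"
    then have hs: "half_synchronized X" "half_synchronized Y" "half_synchronized Z"
      and "common_hs_hyperbolic_extension X Y" "common_hs_hyperbolic_extension Y Z" by auto
    then obtain V W :: "(int \<Rightarrow> 'a) set" and f g h k where
      VW: "hyperbolic f V X" "hyperbolic g V Y" "hyperbolic h W Y" "hyperbolic k W Z"
      unfolding common_hs_hyperbolic_extension_def by blast
    obtain U :: "(int \<Rightarrow> 'a) set" and p q where
      U: "half_synchronized U" "hyperbolic p U V" "hyperbolic q U W"
      using common_hyperbolic_extension[OF VW(2,3) hs(2)] by blast
    have "hyperbolic (\<lambda>x. f (p x)) U X" "hyperbolic (\<lambda>x. k (q x)) U Z"
      using hyperbolic_compose U(2,3) VW(1,4) by blast+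
    then have "common_hs_hyperbolic_extension X Z"
      using U(1) unfolding common_hs_hyperbolic_extension_def by blast
    with hs show "(X, Z) \<in> ?r" by blast
  qed
qed

end
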